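(* Let $d(n)$ be a sequence with $d(n)=o(\sqrt n)$. For each even $n$ let $f_n$ be a real harmonic multilinear polynomial in $x_1,\dots,x_n$ of degree at most $d(n)$, regarded as a function on $\{0,1\}^n$, with variance $1$ with respect to $\nu$, where $\nu=\nu^{(n)}$ is the uniform measure on $\{x\in\{0,1\}^n:\sum_i x_i=n/2\}$, and let $\mu=\mu^{(n)}$ be the uniform measure on $\{0,1\}^n$. Then, as $n\to\infty$ through even integers: (1) for any $1$-Lipschitz functions $\varphi_n\colon\mathbb R\to\mathbb R$, $$\bigl|\mathbb E_{\nu}[\varphi_n(f_n)]-\mathbb E_{\mu}[\varphi_n(f_n)]\bigr|=o(1);$$ (2) the Lévy distance between the distribution of $f_n$ under $\mu$ and the distribution of $f_n$ under $\nu$ is $o(1)$.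
   Context: A polynomial in $x_1,\dots,x_n$ is multilinear if all its monomials are squarefree, and harmonic if $\sum_{i=1}^n \frac{\partial f}{\partial x_i}=0$. A function $\varphi$ is $1$-Lipschitz if $|\varphi(x)-\varphi(y)|\le|x-y|$ for all $x,y$. The Lévy distance between two real random variables $X,Y$ is the infimum of all $\epsilon$ such that for all $t\in\mathbb R$, $\Pr[X\le t-\epsilon]-\epsilon\le\Pr[Y\le t]\le\Pr[X\le t+\epsilon]+\epsilon$. *)

theory Defs
  imports "HOL-Probability.Probability" "HOL-Library.Poly_Mapping" "HOL-Library.Landau_Symbols"
begin

text \<open>
  A real polynomial in the variables \<open>x\<^sub>1, x\<^sub>2, \<dots>\<close> is a finitely supported map from
  monomials to coefficients; a monomial is a finitely supported map from variable indices to
  exponents.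
\<close>

type_synonym monomial = "nat \<Rightarrow>\<^sub>0 nat"
type_synonym mpolynomial = "monomial \<Rightarrow>\<^sub>0 real"

definition mpoly_vars :: "mpolynomial \<Rightarrow> nat set" where
  "mpoly_vars p = (\<Union>m\<in>Poly_Mapping.keys p. Poly_Mapping.keys m)"

definition mpoly_eval :: "mpolynomial \<Rightarrow> (nat \<Rightarrow> real) \<Rightarrow> real" where
  "mpoly_eval p x = (\<Sum>m\<in>Poly_Mapping.keys p. Poly_Mapping.lookup p m *
     (\<Prod>i\<in>Poly_Mapping.keys m. x i ^ Poly_Mapping.lookup m i))"

definition monomial_degree :: "monomial \<Rightarrow> nat" where
  "monomial_degree m = (\<Sum>i\<in>Poly_Mapping.keys m. Poly_Mapping.lookup m i)"

text \<open>Total degree; the zero polynomial gets degree 0.\<close>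

definition mpoly_degree :: "mpolynomial \<Rightarrow> nat" where
  "mpoly_degree p = Max (insert 0 (monomial_degree ` Poly_Mapping.keys p))"

text \<open>
  The formal derivative with respect to \<open>x\<^sub>i\<close>. If \<open>x\<^sub>i\<close> does not occur in \<open>m\<close>, the truncated
  subtraction of exponents is harmless, because the coefficient then vanishes.
\<close>

definition mpoly_deriv :: "nat \<Rightarrow> mpolynomial \<Rightarrow> mpolynomial" where
  "mpoly_deriv i p = (\<Sum>m\<in>Poly_Mapping.keys p.
     Poly_Mapping.single (m - Poly_Mapping.single i 1)
       (real (Poly_Mapping.lookup m i) * Poly_Mapping.lookup p m))"

definition multilinear :: "mpolynomial \<Rightarrow> bool" where
  "multilinear p \<longleftrightarrow> (\<forall>m\<in>Poly_Mapping.keys p. \<forall>i. Poly_Mapping.lookup m i \<le> 1)"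

definition harmonic :: "nat \<Rightarrow> mpolynomial \<Rightarrow> bool" where
  "harmonic n p \<longleftrightarrow> (\<Sum>i=1..n. mpoly_deriv i p) = 0"

definition cube :: "nat \<Rightarrow> (nat \<Rightarrow> real) set" where
  "cube n = ({1..n} \<rightarrow>\<^sub>E {0, 1})"

definition middle_slice :: "nat \<Rightarrow> (nat \<Rightarrow> real) set" where
  "middle_slice n = {x \<in> cube n. (\<Sum>i=1..n. x i) = real n / 2}"

definition cube_pmf :: "nat \<Rightarrow> (nat \<Rightarrow> real) pmf" where
  "cube_pmf n = pmf_of_set (cube n)"

text \<open>Meaningful only for even \<open>n\<close>: otherwise the slice is empty and
  \<^const>\<open>pmf_of_set\<close> is unspecified.\<close>

definition slice_pmf :: "nat \<Rightarrow> (nat \<Rightarrow> real) pmf" where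
  "slice_pmf n = pmf_of_set (middle_slice n)"

text \<open>
  The Levy distance of two real distributions, given as measures on the reals. No condition
  \<open>\<epsilon> \<ge> 0\<close> is needed: for probability measures every admissible \<open>\<epsilon>\<close> is nonnegative, and
  \<open>\<epsilon> = 1\<close> is admissible.
\<close>

definition levy_distance :: "real measure \<Rightarrow> real measure \<Rightarrow> real" where
  "levy_distance M N = Inf {\<epsilon>. \<forall>t. cdf M (t - \<epsilon>) - \<epsilon> \<le> cdf N t \<and> cdf N t \<le> cdf M (t + \<epsilon>) + \<epsilon>}"

definition even_at_top :: "nat filter" where
  "even_at_top = inf at_top (principal {n. even n})"

end

theory Submission
  imports Defs
begin

text \<open>
  The idea is to couple a uniform point \<open>X\<close> of the cube with a uniform point \<open>Y\<close> of the middle slice so that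
  \<open>f X\<close> and \<open>f Y\<close> are close in mean square. Closeness in mean square gives both conclusions at
  once: the first because a 1-Lipschitz function does not increase distances, the second by Markov's
  inequality.

  Identify points of the cube with subsets of \<open>N = {1..n}\<close>, where \<open>n = 2 * m\<close>. The coupling chooses \<open>X\<close> uniformly
  and then \<open>Y\<close> uniformly among the \<open>m\<close>-sets that contain \<open>X\<close> or are contained in \<open>X\<close>. It has the right
  marginals and is invariant under permutations of the coordinates.

  Invariance is what harmonicity interacts with. The correlation of two monomials \<open>A\<close>, \<open>B\<close> under an
  invariant pair of random points depends only on the cardinalities of \<open>A\<close>, \<open>B\<close> and \<open>A \<inter> B\<close>. Expanding the
  dependence on \<open>card (A \<inter> B)\<close> in binomial coefficients, and using that for harmonic \<open>f\<close> the sum of the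
  coefficients of degree \<open>k\<close> over all supersets of a smaller set vanishes, one finds that every
  invariant pair acts on harmonic polynomials as a scalar in each degree (\<open>invariant_form_diagonal\<close>).
  The scalar is found from a product of \<open>k\<close> differences of coordinates: for degree \<open>k\<close> it is \<open>2 ^ (-k)\<close> times the
  expectation of the product of \<open>(x_a - x_b) * (y_a - y_b)\<close> over \<open>k\<close> disjoint pairs \<open>(a, b)\<close>.

  For the uniform measure on the cube or on the slice this is a probability that a random point
  splits \<open>k\<close> pairs; it is smaller on the cube (\<open>split_probability_cube_le_slice\<close>). For the coupling, since \<open>X\<close> and \<open>Y\<close>
  are comparable, it is the probability that both points split all \<open>k\<close> pairs. Given that \<open>Y\<close>
  does, \<open>X\<close> fails to do so with probability at most \<open>k\<close> times the mean of \<open>\<bar>card X - m\<bar>\<close> divided by \<open>m\<close>, which is at most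
  \<open>k / sqrt n\<close> (\<open>split_correlation_lower_bound\<close>, \<open>mean_gap_le\<close>). Adding up the degrees, the mean square of
  \<open>f X - f Y\<close> is at most \<open>2 * d n / sqrt n\<close> times the variance of \<open>f\<close> on the slice
  (\<open>coupling_mean_square_le\<close>), and this tends to 0.
\<close>

section \<open>Harmonic coefficient functions and invariant bilinear forms\<close>

text \<open>
  A point of the cube is a set \<open>X \<subseteq> N\<close>, a squarefree monomial is a set \<open>A \<subseteq> N\<close>, and the monomial takes
  the value 1 at \<open>X\<close> if \<open>A \<subseteq> X\<close> and 0 otherwise.
\<close>

definition mlin :: "'a set \<Rightarrow> ('a set \<Rightarrow> real) \<Rightarrow> 'a set \<Rightarrow> real" where
  "mlin N c X = (\<Sum>A\<in>Pow N. c A * of_bool (A \<subseteq> X))"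

text \<open>
  The coefficient of the monomial \<open>B\<close> in the sum of all partial derivatives is the sum of
  \<open>c (insert i B)\<close> over \<open>i \<notin> B\<close>.
\<close>

definition coeff_harmonic :: "'a set \<Rightarrow> ('a set \<Rightarrow> real) \<Rightarrow> bool" where
  "coeff_harmonic N c \<longleftrightarrow> (\<forall>B\<subseteq>N. (\<Sum>i\<in>N - B. c (insert i B)) = 0)"

text \<open>
  For \<open>card D < k\<close>, count every \<open>c A\<close> once for each \<open>i \<in> A - D\<close>: this multiplies the sum by
  \<open>k - card D\<close>. Grouped by \<open>B = A - {i}\<close>, the same terms are sums of \<open>c (insert i B)\<close> over \<open>i \<notin> B\<close>, which
  vanish.
\<close>

lemma sum_level_supersets:
  assumes "finite N" "coeff_harmonic N c" "D \<subseteq> N"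
  shows "(\<Sum>A | A \<subseteq> N \<and> card A = k \<and> D \<subseteq> A. c A) = (if card D = k then c D else 0)"
proof (cases "card D < k")
  case False
  have "{A. A \<subseteq> N \<and> card A = k \<and> D \<subseteq> A} = (if card D = k then {D} else {})"
    using False assms(1,3)
    by (auto dest: card_mono[rotated] finite_subset) (metis card_subset_eq finite_subset le_neq_implies_less card_mono)+
  then show ?thesis by simp
next
  case True
  let ?L = "{A. A \<subseteq> N \<and> card A = k \<and> D \<subseteq> A}" and ?M = "{B. B \<subseteq> N \<and> card B = k - 1 \<and> D \<subseteq> B}"
  have fin: "finite X" if "X \<subseteq> N" for X using that assms(1) finite_subset by blast
  have finL: "finite ?L" "finite ?M" using assms(1) by auto
  have "real (k - card D) * sum c ?L = (\<Sum>A\<in>?L. \<Sum>i\<in>A - D. c A)"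
    unfolding sum_distrib_left
    by (rule sum.cong) (auto simp: card_Diff_subset fin assms(3))
  also have "\<dots> = (\<Sum>(A, i)\<in>(SIGMA A:?L. A - D). c A)"
    by (rule sum.Sigma) (use finL fin in auto)
  also have "\<dots> = (\<Sum>(B, i)\<in>(SIGMA B:?M. N - B). c (insert i B))"
    by (rule sum.reindex_bij_witness[where i = "\<lambda>(B, i). (insert i B, i)" and j = "\<lambda>(A, i). (A - {i}, i)"])
      (use True assms(1) in \<open>auto simp: insert_absorb fin card_insert_if\<close>)
  also have "\<dots> = (\<Sum>B\<in>?M. \<Sum>i\<in>N - B. c (insert i B))"
    by (rule sum.Sigma[symmetric]) (use finL assms(1) in auto)
  also have "\<dots> = 0"
    using assms(2) by (intro sum.neutral) (auto simp: coeff_harmonic_def)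
  finally show ?thesis using True by simp
qed

lemma sum_Pow_card:
  assumes "finite S"
  shows "(\<Sum>D\<in>Pow S. g (card D)) = (\<Sum>D\<in>Pow {..<card S}. g (card D))"
proof -
  obtain h where h: "bij_betw h S {..<card S}"
    using ex_bij_betw_finite_nat[OF assms] by (auto simp: atLeast0LessThan)
  have "(\<Sum>D\<in>Pow S. g (card D)) = (\<Sum>D\<in>Pow S. g (card (h ` D)))"
  proof (rule sum.cong[OF refl])
    fix D assume "D \<in> Pow S"
    then have "card (h ` D) = card D"
      using h by (auto simp: bij_betw_def intro!: card_image elim: inj_on_subset)
    then show "g (card D) = g (card (h ` D))" by simp
  qed
  also have "\<dots> = (\<Sum>D\<in>Pow {..<card S}. g (card D))"
    by (rule sum.reindex_bij_betw[OF bij_betw_Pow[OF h]])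
  finally show ?thesis .
qed

text \<open>
  The coefficient of the binomial polynomial \<open>t choose k\<close> in the Newton expansion of \<open>g\<close>, that
  is, the \<open>k\<close>-th forward difference of \<open>g\<close> at 0. Summing over subsets of \<open>{..<k}\<close> instead of over
  \<open>j \<le> k\<close> with binomial coefficients makes Moebius inversion on the subset lattice applicable.
\<close>

definition newton_coeff :: "(nat \<Rightarrow> real) \<Rightarrow> nat \<Rightarrow> real" where
  "newton_coeff g k = (\<Sum>D\<in>Pow {..<k}. (-1) ^ (k + card D) * g (card D))"

lemma newton_expansion:
  assumes "finite S"
  shows "g (card S) = (\<Sum>D\<in>Pow S. newton_coeff g (card D))"
proof -
  have 1: "(-1) ^ card T * newton_coeff g (card T) = (\<Sum>D\<in>Pow T. (-1) ^ card D * g (card D))" if "finite T" for T :: "'a set"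
    unfolding newton_coeff_def sum_Pow_card[OF that, of "\<lambda>t. (-1) ^ t * g t"] sum_distrib_left
    by (rule sum.cong) (auto simp: power_add)
  show ?thesis
    using inclusion_exclusion_symmetric[of "\<lambda>T::'a set. (-1) ^ card T * newton_coeff g (card T)" "\<lambda>T. g (card T)", OF 1 assms]
    by (simp flip: mult.assoc power_add)
qed

lemma sum_Pow_by_card:
  assumes "finite N"
  shows "(\<Sum>A\<in>Pow N. f A) = (\<Sum>k\<le>card N. \<Sum>A | A \<subseteq> N \<and> card A = k. f A)"
proof -
  have "(\<Sum>k\<in>{..card N}. sum f {A \<in> Pow N. card A = k}) = sum f (Pow N)"
    by (rule sum.group) (use assms in \<open>auto simp: card_mono\<close>)
  then show ?thesis by simp
qed

text \<open>
  Write the kernel in its Newton expansion: a function of \<open>card (A \<inter> B)\<close> is a combination over \<open>D\<close>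
  of the products of the conditions \<open>D \<subseteq> A\<close> and \<open>D \<subseteq> B\<close>. By \<open>sum_level_supersets\<close>, harmonic coefficients of
  degrees \<open>k\<close> and \<open>l\<close> survive only when \<open>card D = k = l\<close>, and then leave \<open>c D * e D\<close>. So any such kernel is
  diagonal on harmonic coefficients, and acts as a scalar in each degree.
\<close>

lemma harmonic_bilinear_diagonal:
  assumes N: "finite N" and c: "coeff_harmonic N c" and e: "coeff_harmonic N e"
    and q: "\<And>A B. A \<subseteq> N \<Longrightarrow> B \<subseteq> N \<Longrightarrow> q A B = \<phi> (card A) (card B) (card (A \<inter> B))"
  shows "(\<Sum>A\<in>Pow N. \<Sum>B\<in>Pow N. c A * e B * q A B)
       = (\<Sum>D\<in>Pow N. newton_coeff (\<phi> (card D) (card D)) (card D) * c D * e D)"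
proof -
  have fin: "finite X" if "X \<subseteq> N" for X using that N finite_subset by blast
  have qe: "q A B = (\<Sum>D\<in>Pow N. newton_coeff (\<phi> (card A) (card B)) (card D) * of_bool (D \<subseteq> A) * of_bool (D \<subseteq> B))"
    if "A \<subseteq> N" "B \<subseteq> N" for A B
  proof -
    have "q A B = (\<Sum>D\<in>Pow (A \<inter> B). newton_coeff (\<phi> (card A) (card B)) (card D))"
      unfolding q[OF that] by (rule newton_expansion) (use fin that in blast)
    also have "\<dots> = (\<Sum>D\<in>Pow N. if D \<in> Pow (A \<inter> B) then newton_coeff (\<phi> (card A) (card B)) (card D) else 0)"
      using that N by (subst sum.inter_restrict[symmetric]) (auto intro!: sum.cong)
    also have "\<dots> = (\<Sum>D\<in>Pow N. newton_coeff (\<phi> (card A) (card B)) (card D) * of_bool (D \<subseteq> A) * of_bool (D \<subseteq> B))"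
      by (rule sum.cong) auto
    finally show ?thesis .
  qed
  have level: "(\<Sum>A | A \<subseteq> N \<and> card A = k. c' A * of_bool (D \<subseteq> A)) = (if card D = k then c' D else 0)"
    if "coeff_harmonic N c'" "D \<subseteq> N" for c' D k
  proof -
    have "(\<Sum>A | A \<subseteq> N \<and> card A = k. c' A * of_bool (D \<subseteq> A)) = (\<Sum>A | A \<subseteq> N \<and> card A = k \<and> D \<subseteq> A. c' A)"
      using N by (intro sum.mono_neutral_cong_right) auto
    then show ?thesis using sum_level_supersets[OF N that] by simp
  qed
  have "(\<Sum>A\<in>Pow N. \<Sum>B\<in>Pow N. c A * e B * q A B)
      = (\<Sum>k\<le>card N. \<Sum>A | A \<subseteq> N \<and> card A = k. \<Sum>l\<le>card N. \<Sum>B | B \<subseteq> N \<and> card B = l. c A * e B * q A B)"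
    by (simp add: sum_Pow_by_card[OF N])
  also have "\<dots> = (\<Sum>k\<le>card N. \<Sum>A | A \<subseteq> N \<and> card A = k. \<Sum>l\<le>card N. \<Sum>B | B \<subseteq> N \<and> card B = l. \<Sum>D\<in>Pow N.
       newton_coeff (\<phi> k l) (card D) * (c A * of_bool (D \<subseteq> A)) * (e B * of_bool (D \<subseteq> B)))"
    by (intro sum.cong refl) (simp add: qe sum_distrib_left mult_ac)
  also have "\<dots> = (\<Sum>k\<le>card N. \<Sum>l\<le>card N. \<Sum>D\<in>Pow N.
       newton_coeff (\<phi> k l) (card D) * (\<Sum>A | A \<subseteq> N \<and> card A = k. c A * of_bool (D \<subseteq> A)) * (\<Sum>B | B \<subseteq> N \<and> card B = l. e B * of_bool (D \<subseteq> B)))"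
  proof (intro sum.cong refl)
    fix k
    let ?L = "\<lambda>k. {A. A \<subseteq> N \<and> card A = k}"
    have "(\<Sum>A\<in>?L k. \<Sum>l\<le>card N. \<Sum>B\<in>?L l. \<Sum>D\<in>Pow N. newton_coeff (\<phi> k l) (card D) * (c A * of_bool (D \<subseteq> A)) * (e B * of_bool (D \<subseteq> B)))
      = (\<Sum>l\<le>card N. \<Sum>A\<in>?L k. \<Sum>B\<in>?L l. \<Sum>D\<in>Pow N. newton_coeff (\<phi> k l) (card D) * (c A * of_bool (D \<subseteq> A)) * (e B * of_bool (D \<subseteq> B)))"
      by (rule sum.swap)
    also have "\<dots> = (\<Sum>l\<le>card N. \<Sum>A\<in>?L k. \<Sum>D\<in>Pow N. \<Sum>B\<in>?L l. newton_coeff (\<phi> k l) (card D) * (c A * of_bool (D \<subseteq> A)) * (e B * of_bool (D \<subseteq> B)))"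
      by (rule sum.cong[OF refl], rule sum.cong[OF refl], rule sum.swap)
    also have "\<dots> = (\<Sum>l\<le>card N. \<Sum>D\<in>Pow N. \<Sum>A\<in>?L k. \<Sum>B\<in>?L l. newton_coeff (\<phi> k l) (card D) * (c A * of_bool (D \<subseteq> A)) * (e B * of_bool (D \<subseteq> B)))"
      by (rule sum.cong[OF refl], rule sum.swap)
    also have "\<dots> = (\<Sum>l\<le>card N. \<Sum>D\<in>Pow N. newton_coeff (\<phi> k l) (card D) * (\<Sum>A\<in>?L k. c A * of_bool (D \<subseteq> A)) * (\<Sum>B\<in>?L l. e B * of_bool (D \<subseteq> B)))"
      by (simp only: sum_distrib_left sum_distrib_right)
        (rule sum.cong[OF refl], rule sum.cong[OF refl], rule sum.swap)
    finally show "(\<Sum>A\<in>?L k. \<Sum>l\<le>card N. \<Sum>B\<in>?L l. \<Sum>D\<in>Pow N. newton_coeff (\<phi> k l) (card D) * (c A * of_bool (D \<subseteq> A)) * (e B * of_bool (D \<subseteq> B))) = \<dots>" .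
  qed
  also have "\<dots> = (\<Sum>k\<le>card N. \<Sum>l\<le>card N. \<Sum>D\<in>Pow N.
       newton_coeff (\<phi> k l) (card D) * (if card D = k then c D else 0) * (if card D = l then e D else 0))"
    by (intro sum.cong refl) (auto simp: level c e)
  also have "\<dots> = (\<Sum>k\<le>card N. \<Sum>D\<in>Pow N. \<Sum>l\<le>card N.
       newton_coeff (\<phi> k l) (card D) * (if card D = k then c D else 0) * (if card D = l then e D else 0))"
    by (rule sum.cong[OF refl], rule sum.swap)
  also have "\<dots> = (\<Sum>D\<in>Pow N. \<Sum>k\<le>card N. \<Sum>l\<le>card N.
       newton_coeff (\<phi> k l) (card D) * (if card D = k then c D else 0) * (if card D = l then e D else 0))"
    by (rule sum.swap)
  also have "\<dots> = (\<Sum>D\<in>Pow N. newton_coeff (\<phi> (card D) (card D)) (card D) * c D * e D)"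
  proof (intro sum.cong refl)
    fix D assume D: "D \<in> Pow N"
    then have "card D \<le> card N" using N by (auto simp: card_mono)
    have "(\<Sum>k\<le>card N. \<Sum>l\<le>card N. newton_coeff (\<phi> k l) (card D) * (if card D = k then c D else 0) * (if card D = l then e D else 0))
      = (\<Sum>k\<le>card N. if card D = k then newton_coeff (\<phi> k (card D)) (card D) * c D * e D else 0)"
      using \<open>card D \<le> card N\<close> by (intro sum.cong refl) (simp add: if_distrib[of "\<lambda>x. _ * x"] cong: if_cong)
    then show "(\<Sum>k\<le>card N. \<Sum>l\<le>card N. newton_coeff (\<phi> k l) (card D) * (if card D = k then c D else 0) * (if card D = l then e D else 0))
       = newton_coeff (\<phi> (card D) (card D)) (card D) * c D * e D"
      using \<open>card D \<le> card N\<close> by simp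
  qed
  finally show ?thesis .
qed

lemma sum_swap_pairs:
  "(\<Sum>x\<in>P. \<Sum>y\<in>Q. \<Sum>u\<in>R. \<Sum>v\<in>S. f x y u v) = (\<Sum>u\<in>R. \<Sum>v\<in>S. \<Sum>x\<in>P. \<Sum>y\<in>Q. f x y u v :: 'b :: comm_monoid_add)"
proof -
  have "(\<Sum>x\<in>P. \<Sum>y\<in>Q. \<Sum>u\<in>R. \<Sum>v\<in>S. f x y u v)
      = (\<Sum>x\<in>P. \<Sum>u\<in>R. \<Sum>v\<in>S. \<Sum>y\<in>Q. f x y u v)"
    by (simp only: sum.swap[of _ _ Q])
  also have "\<dots> = (\<Sum>u\<in>R. \<Sum>v\<in>S. \<Sum>x\<in>P. \<Sum>y\<in>Q. f x y u v)"
    by (simp only: sum.swap[of _ _ P])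
  finally show ?thesis .
qed

text \<open>
  \<open>W X Y\<close> is the weight of the pair \<open>(X, Y)\<close> under a joint distribution of two random points of
  the cube; invariance is under simultaneous permutation of the coordinates of both points.
\<close>

definition perm_invariant :: "'a set \<Rightarrow> ('a set \<Rightarrow> 'a set \<Rightarrow> real) \<Rightarrow> bool" where
  "perm_invariant N W \<longleftrightarrow> (\<forall>p. p permutes N \<longrightarrow> (\<forall>X\<subseteq>N. \<forall>Y\<subseteq>N. W (p ` X) (p ` Y) = W X Y))"

lemma permutes_two_sets:
  assumes N: "finite N" and sub: "A \<subseteq> N" "B \<subseteq> N" "A' \<subseteq> N" "B' \<subseteq> N"
    and cards: "card A = card A'" "card B = card B'" "card (A \<inter> B) = card (A' \<inter> B')"
  obtains p where "p permutes N" "p ` A = A'" "p ` B = B'"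
proof -
  have fin: "finite X" if "X \<subseteq> N" for X using that N finite_subset by blast
  have c2: "card {x \<in> N. x \<in> U \<and> x \<in> V} = card (U \<inter> V)"
     "card {x \<in> N. x \<in> U \<and> x \<notin> V} = card U - card (U \<inter> V)"
     "card {x \<in> N. x \<notin> U \<and> x \<in> V} = card V - card (U \<inter> V)"
     "card {x \<in> N. x \<notin> U \<and> x \<notin> V} = card N - (card U + card V - card (U \<inter> V))"
    if "U \<subseteq> N" "V \<subseteq> N" for U V
  proof -
    have e: "{x \<in> N. x \<in> U \<and> x \<in> V} = U \<inter> V" "{x \<in> N. x \<in> U \<and> x \<notin> V} = U - V"
      "{x \<in> N. x \<notin> U \<and> x \<in> V} = V - U" "{x \<in> N. x \<notin> U \<and> x \<notin> V} = N - (U \<union> V)"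
      using that by auto
    have "card (U \<union> V) = card U + card V - card (U \<inter> V)"
      using card_Un_Int[of U V] fin that by simp
    then show "card {x \<in> N. x \<in> U \<and> x \<in> V} = card (U \<inter> V)"
     "card {x \<in> N. x \<in> U \<and> x \<notin> V} = card U - card (U \<inter> V)"
     "card {x \<in> N. x \<notin> U \<and> x \<in> V} = card V - card (U \<inter> V)"
     "card {x \<in> N. x \<notin> U \<and> x \<notin> V} = card N - (card U + card V - card (U \<inter> V))"
      unfolding e using fin that
      by (auto simp: card_Diff_subset_Int[of V U] card_Diff_subset_Int[of U V] card_Diff_subset[of "U \<union> V" N] Int_commute)
  qed
  have "image_mset (\<lambda>x. (x \<in> A, x \<in> B)) (mset_set N) = image_mset (\<lambda>x. (x \<in> A', x \<in> B')) (mset_set N)"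
  proof (rule multiset_eqI)
    fix z :: "bool \<times> bool"
    have cnt: "count (image_mset f (mset_set N)) w = card {x \<in> N. f x = w}" for w and f :: "'a \<Rightarrow> bool \<times> bool"
    proof -
      have "count (image_mset f (mset_set N)) w = (\<Sum>y\<in>f -` {w} \<inter> N. count (mset_set N) y)"
        using N by (simp add: count_image_mset)
      also have "\<dots> = (\<Sum>y\<in>f -` {w} \<inter> N. 1)"
        by (rule sum.cong) (use N in auto)
      also have "\<dots> = card {x \<in> N. f x = w}"
        by (simp add: vimage_def Int_def conj_commute)
      finally show ?thesis .
    qed
    show "count (image_mset (\<lambda>x. (x \<in> A, x \<in> B)) (mset_set N)) z = count (image_mset (\<lambda>x. (x \<in> A', x \<in> B')) (mset_set N)) z"
    proof -
      obtain u v where z: "z = (u, v)" by (cases z)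
      show ?thesis
        unfolding cnt z prod.inject eq_True eq_False
        by (cases u; cases v; simp only: eq_True eq_False not_True_eq_False not_False_eq_True simp_thms c2[OF sub(1,2)] c2[OF sub(3,4)] cards)
    qed
  qed
  from image_mset_eq_implies_permutes[OF N this] obtain p where
    p: "p permutes N" "\<forall>x\<in>N. (x \<in> A, x \<in> B) = (p x \<in> A', p x \<in> B')" by blast
  have im: "p ` U = U'" if "U \<subseteq> N" "U' \<subseteq> N" "\<And>x. x \<in> N \<Longrightarrow> x \<in> U \<longleftrightarrow> p x \<in> U'" for U U'
  proof
    show "p ` U \<subseteq> U'" using that by auto
    show "U' \<subseteq> p ` U"
    proof
      fix y assume "y \<in> U'"
      then have "y \<in> p ` N" using that p(1) by (auto simp: permutes_image)
      then show "y \<in> p ` U" using \<open>y \<in> U'\<close> that(3) by auto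
    qed
  qed
  show ?thesis by (rule that[OF p(1)]; rule im) (use p sub in auto)
qed

lemma sum_Pow_permutes:
  assumes "p permutes N"
  shows "(\<Sum>X\<in>Pow N. f (p ` X)) = (\<Sum>X\<in>Pow N. f X)"
  by (rule sum.reindex_bij_betw[OF bij_betw_Pow]) (use assms permutes_imp_bij in blast)

definition joint_moment :: "'a set \<Rightarrow> ('a set \<Rightarrow> 'a set \<Rightarrow> real) \<Rightarrow> 'a set \<Rightarrow> 'a set \<Rightarrow> real" where
  "joint_moment N W A B = (\<Sum>X\<in>Pow N. \<Sum>Y\<in>Pow N. W X Y * of_bool (A \<subseteq> X) * of_bool (B \<subseteq> Y))"

lemma joint_moment_permutes:
  assumes "perm_invariant N W" "p permutes N"
  shows "joint_moment N W (p ` A) (p ` B) = joint_moment N W A B"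
proof -
  have "joint_moment N W (p ` A) (p ` B) = (\<Sum>X\<in>Pow N. \<Sum>Y\<in>Pow N.
      W (p ` X) (p ` Y) * of_bool (p ` A \<subseteq> p ` X) * of_bool (p ` B \<subseteq> p ` Y))"
    unfolding joint_moment_def
    by (subst sum_Pow_permutes[OF assms(2), symmetric], subst (2) sum_Pow_permutes[OF assms(2), symmetric]) simp
  also have "\<dots> = joint_moment N W A B"
    unfolding joint_moment_def using assms
    by (intro sum.cong refl) (simp add: perm_invariant_def inj_image_subset_iff permutes_inj)
  finally show ?thesis .
qed

text \<open>
  The orbit of a pair of sets under permutations is determined by these three cardinalities.
\<close>

lemma joint_moment_card:
  assumes "finite N" "perm_invariant N W"
  obtains \<phi> where "\<And>A B. A \<subseteq> N \<Longrightarrow> B \<subseteq> N \<Longrightarrow> joint_moment N W A B = \<phi> (card A) (card B) (card (A \<inter> B))"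
proof -
  let ?P = "\<lambda>k l t S. fst S \<subseteq> N \<and> snd S \<subseteq> N \<and> card (fst S) = k \<and> card (snd S) = l \<and> card (fst S \<inter> snd S) = t"
  define R where "R k l t = (SOME S. ?P k l t S)" for k l t
  show ?thesis
  proof (rule that)
    fix A B assume AB: "A \<subseteq> N" "B \<subseteq> N"
    let ?S = "R (card A) (card B) (card (A \<inter> B))"
    have "?P (card A) (card B) (card (A \<inter> B)) ?S"
      unfolding R_def by (rule someI[of _ "(A, B)"]) (use AB in auto)
    then obtain p where "p permutes N" "p ` A = fst ?S" "p ` B = snd ?S"
      using permutes_two_sets[OF assms(1) AB, of "fst ?S" "snd ?S"] by metis
    then show "joint_moment N W A B = (\<lambda>k l t. joint_moment N W (fst (R k l t)) (snd (R k l t))) (card A) (card B) (card (A \<inter> B))"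
      using joint_moment_permutes[OF assms(2), of p A B] by simp
  qed
qed

definition pair_diff :: "(nat \<Rightarrow> 'a) \<Rightarrow> (nat \<Rightarrow> 'a) \<Rightarrow> nat \<Rightarrow> 'a set \<Rightarrow> real" where
  "pair_diff a b i X = of_bool (a i \<in> X) - of_bool (b i \<in> X)"

text \<open>
  The pairs \<open>(a i, b i)\<close> with \<open>i < k\<close> are used to evaluate scalars: the product of the \<open>pair_diff a b i\<close>
  over \<open>i < k\<close>, that is, of the differences of coordinates \<open>a i\<close> and \<open>b i\<close>, is the simplest harmonic
  polynomial of degree \<open>k\<close>.
\<close>

definition disjoint_pairs :: "'a set \<Rightarrow> nat \<Rightarrow> (nat \<Rightarrow> 'a) \<Rightarrow> (nat \<Rightarrow> 'a) \<Rightarrow> bool" where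
  "disjoint_pairs N k a b \<longleftrightarrow> inj_on a {..<k} \<and> inj_on b {..<k} \<and> a ` {..<k} \<inter> b ` {..<k} = {}
     \<and> a ` {..<k} \<union> b ` {..<k} \<subseteq> N"

lemma disjoint_pairs_mono:
  assumes "disjoint_pairs N K a b" "k \<le> K"
  shows "disjoint_pairs N k a b"
proof -
  have sub: "{..<k} \<subseteq> {..<K}" using assms(2) by auto
  then have "a ` {..<k} \<subseteq> a ` {..<K}" "b ` {..<k} \<subseteq> b ` {..<K}" by (auto intro: image_mono)
  moreover have "inj_on a {..<k}" "inj_on b {..<k}"
    using assms(1) sub by (auto simp: disjoint_pairs_def elim: inj_on_subset)
  moreover have "a ` {..<K} \<inter> b ` {..<K} = {}" "a ` {..<K} \<union> b ` {..<K} \<subseteq> N"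
    using assms(1) by (simp_all add: disjoint_pairs_def)
  ultimately show ?thesis unfolding disjoint_pairs_def by (intro conjI) (assumption | blast)+
qed

lemma prod_of_bool: "finite I \<Longrightarrow> (\<Prod>i\<in>I. of_bool (P i)) = (of_bool (\<forall>i\<in>I. P i) :: real)"
  by (induction I rule: finite_induct) auto

lemma prod_pair_diff:
  "(\<Prod>i<k. pair_diff a b i X) =
     (\<Sum>J\<in>Pow {..<k}. (-1) ^ (k + card J) * of_bool (a ` J \<union> b ` ({..<k} - J) \<subseteq> X))"
proof -
  have *: "(-1) ^ (k - card J) = (-1::real) ^ (k + card J)" if "J \<subseteq> {..<k}" for J
    using card_mono[of "{..<k}" J] that by (simp add: minus_one_power_iff)
  have "(\<Prod>i<k. pair_diff a b i X) = (\<Sum>J\<in>Pow {..<k}. (-1) ^ (k - card J) *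
      (\<Prod>i\<in>J. of_bool (a i \<in> X)) * (\<Prod>i\<in>{..<k} - J. of_bool (b i \<in> X)))"
    unfolding pair_diff_def by (subst prod_diff_conv_sum') auto
  also have "\<dots> = (\<Sum>J\<in>Pow {..<k}. (-1) ^ (k + card J) * of_bool (a ` J \<union> b ` ({..<k} - J) \<subseteq> X))"
    by (intro sum.cong refl)
      (auto simp: prod_of_bool * finite_subset image_subset_iff)
  finally show ?thesis .
qed

text \<open>
  Expanding both products over subsets \<open>J\<close>, \<open>J'\<close> of \<open>{..<k}\<close> gives moments of transversals of the pairs.
  Two transversals meet exactly in the indices at which \<open>J\<close> and \<open>J'\<close> agree, and for fixed \<open>J\<close> the
  agreement set runs through all subsets once; the inner sum is therefore the definition of
  \<open>newton_coeff\<close>, whatever \<open>J\<close> is.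
\<close>

lemma newton_eq_pair_diff:
  assumes N: "finite N" and q: "\<And>A B. A \<subseteq> N \<Longrightarrow> B \<subseteq> N \<Longrightarrow> joint_moment N W A B = \<phi> (card A) (card B) (card (A \<inter> B))"
    and pairs: "disjoint_pairs N k a b"
  shows "(\<Sum>X\<in>Pow N. \<Sum>Y\<in>Pow N. W X Y * (\<Prod>i<k. pair_diff a b i X * pair_diff a b i Y)) = 2 ^ k * newton_coeff (\<phi> k k) k"
proof -
  let ?I = "{..<k}"
  define T where "T J = a ` J \<union> b ` (?I - J)" for J
  have inj: "inj_on a ?I" "inj_on b ?I" and disj: "a ` ?I \<inter> b ` ?I = {}" and sub: "a ` ?I \<subseteq> N" "b ` ?I \<subseteq> N"
    using pairs by (auto simp: disjoint_pairs_def)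
  have TN: "T J \<subseteq> N" if "J \<subseteq> ?I" for J using that sub by (auto simp: T_def)
  have cU: "card (a ` J \<union> b ` K) = card J + card K" if "J \<subseteq> ?I" "K \<subseteq> ?I" for J K
  proof -
    have "finite J" "finite K" using that finite_subset by blast+
    moreover have "a ` J \<inter> b ` K = {}" using disj that by blast
    ultimately show ?thesis using inj that by (simp add: card_Un_disjoint card_image inj_on_subset)
  qed
  have cT: "card (T J) = k" if "J \<subseteq> ?I" for J
    unfolding T_def using that cU[of J "?I - J"] finite_subset[OF that] card_mono[OF _ that]
    by (simp add: card_Diff_subset)
  define agree where "agree J J' = {i \<in> ?I. i \<in> J \<longleftrightarrow> i \<in> J'}" for J J'
  have cTT: "card (T J \<inter> T J') = card (agree J J')" if "J \<subseteq> ?I" "J' \<subseteq> ?I" for J J'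
  proof -
    have "a ` J \<inter> a ` J' = a ` (J \<inter> J')"
      using inj_on_image_Int[OF inj(1) that] by simp
    moreover have "b ` (?I - J) \<inter> b ` (?I - J') = b ` (?I - (J \<union> J'))"
      using inj_on_image_Int[OF inj(2), of "?I - J" "?I - J'"] by (simp add: Diff_Un)
    moreover have "a ` J \<inter> b ` (?I - J') = {}" "b ` (?I - J) \<inter> a ` J' = {}" using disj that by blast+
    ultimately have "T J \<inter> T J' = a ` (J \<inter> J') \<union> b ` (?I - (J \<union> J'))"
      unfolding T_def Int_Un_distrib Int_Un_distrib2 by simp
    then have "card (T J \<inter> T J') = card (J \<inter> J') + card (?I - (J \<union> J'))"
      using cU[of "J \<inter> J'" "?I - (J \<union> J')"] that by auto
    also have "\<dots> = card ((J \<inter> J') \<union> (?I - (J \<union> J')))"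
      using that by (intro card_Un_disjoint[symmetric]) (auto intro: finite_subset)
    also have "(J \<inter> J') \<union> (?I - (J \<union> J')) = agree J J'"
      unfolding agree_def using that by auto
    finally show ?thesis .
  qed
  have sgn: "(-1::real) ^ (k + card J) * (-1) ^ (k + card J') = (-1) ^ (k + card (agree J J'))"
    if "J \<subseteq> ?I" "J' \<subseteq> ?I" for J J'
  proof -
    have fJ: "finite J" "finite J'" using that finite_subset by blast+
    have "card (agree J J') = card (J \<inter> J') + card (?I - (J \<union> J'))"
    proof -
      have "agree J J' = (J \<inter> J') \<union> (?I - (J \<union> J'))" unfolding agree_def using that by auto
      then show ?thesis using that fJ by (simp add: card_Un_disjoint disjoint_iff)
    qed
    moreover have "card (?I - (J \<union> J')) + card (J \<union> J') = k"
      using that fJ card_mono[of ?I "J \<union> J'"] by (simp add: card_Diff_subset)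
    moreover have "card J + card J' = card (J \<union> J') + card (J \<inter> J')"
      using fJ by (rule card_Un_Int)
    ultimately have "even (card (agree J J') + k + (card J + card J'))" by presburger
    then show ?thesis by (auto simp: minus_one_power_iff simp flip: power_add)
  qed
  have inner: "(\<Sum>J'\<in>Pow ?I. (-1) ^ (k + card (agree J J')) * \<phi> k k (card (agree J J'))) = newton_coeff (\<phi> k k) k"
    if "J \<subseteq> ?I" for J
    unfolding newton_coeff_def
    by (rule sum.reindex_bij_witness[where i = "agree J" and j = "agree J"])
      (use that in \<open>auto simp: agree_def\<close>)
  have "(\<Sum>X\<in>Pow N. \<Sum>Y\<in>Pow N. W X Y * (\<Prod>i<k. pair_diff a b i X * pair_diff a b i Y))
    = (\<Sum>X\<in>Pow N. \<Sum>Y\<in>Pow N. \<Sum>J\<in>Pow ?I. \<Sum>J'\<in>Pow ?I.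
         (-1) ^ (k + card J) * (-1) ^ (k + card J') * (W X Y * of_bool (T J \<subseteq> X) * of_bool (T J' \<subseteq> Y)))"
    unfolding prod.distrib prod_pair_diff T_def[symmetric] sum_product
    by (simp only: sum_distrib_left mult_ac)
  also have "\<dots> = (\<Sum>J\<in>Pow ?I. \<Sum>J'\<in>Pow ?I. \<Sum>X\<in>Pow N. \<Sum>Y\<in>Pow N.
         (-1) ^ (k + card J) * (-1) ^ (k + card J') * (W X Y * of_bool (T J \<subseteq> X) * of_bool (T J' \<subseteq> Y)))"
    by (rule sum_swap_pairs)
  also have "\<dots> = (\<Sum>J\<in>Pow ?I. \<Sum>J'\<in>Pow ?I. (-1) ^ (k + card (agree J J')) * \<phi> k k (card (agree J J')))"
    unfolding sum_distrib_left[symmetric] joint_moment_def[symmetric]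
    by (intro sum.cong refl) (simp add: q TN cT cTT sgn)
  also have "\<dots> = 2 ^ k * newton_coeff (\<phi> k k) k"
    by (simp add: inner card_Pow)
  finally show ?thesis .
qed

text \<open>
  An invariant joint weight acts on harmonic polynomials as a scalar in each degree \<open>k\<close>, and this
  scalar is \<open>2 ^ (-k)\<close> times the joint expectation of the product of the \<open>k\<close> coordinate differences.
  This is what makes norms on the cube and on the slice, and correlations between the two,
  comparable degree by degree.
\<close>

lemma invariant_form_diagonal:
  assumes N: "finite N" and W: "perm_invariant N W" and c: "coeff_harmonic N c" and e: "coeff_harmonic N e"
    and pairs: "disjoint_pairs N K a b" and deg: "\<And>A. A \<subseteq> N \<Longrightarrow> c A \<noteq> 0 \<Longrightarrow> card A \<le> K"
  shows "(\<Sum>X\<in>Pow N. \<Sum>Y\<in>Pow N. W X Y * mlin N c X * mlin N e Y) =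
     (\<Sum>D\<in>Pow N. (\<Sum>X\<in>Pow N. \<Sum>Y\<in>Pow N. W X Y * (\<Prod>i<card D. pair_diff a b i X * pair_diff a b i Y)) / 2 ^ card D
        * (c D * e D))"
proof -
  obtain \<phi> where q: "\<And>A B. A \<subseteq> N \<Longrightarrow> B \<subseteq> N \<Longrightarrow> joint_moment N W A B = \<phi> (card A) (card B) (card (A \<inter> B))"
    using joint_moment_card[OF N W] by blast
  have "(\<Sum>X\<in>Pow N. \<Sum>Y\<in>Pow N. W X Y * mlin N c X * mlin N e Y)
      = (\<Sum>X\<in>Pow N. \<Sum>Y\<in>Pow N. \<Sum>A\<in>Pow N. \<Sum>B\<in>Pow N. c A * e B * (W X Y * of_bool (A \<subseteq> X) * of_bool (B \<subseteq> Y)))"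
    unfolding mlin_def mult.assoc[of "W _ _"] sum_product
    by (simp only: sum_distrib_left mult_ac)
  also have "\<dots> = (\<Sum>A\<in>Pow N. \<Sum>B\<in>Pow N. \<Sum>X\<in>Pow N. \<Sum>Y\<in>Pow N. c A * e B * (W X Y * of_bool (A \<subseteq> X) * of_bool (B \<subseteq> Y)))"
    by (rule sum_swap_pairs)
  also have "\<dots> = (\<Sum>A\<in>Pow N. \<Sum>B\<in>Pow N. c A * e B * joint_moment N W A B)"
    by (simp add: joint_moment_def sum_distrib_left)
  also have "\<dots> = (\<Sum>D\<in>Pow N. newton_coeff (\<phi> (card D) (card D)) (card D) * c D * e D)"
    by (rule harmonic_bilinear_diagonal[where \<phi> = \<phi>, OF N c e]) (rule q)
  also have "\<dots> = (\<Sum>D\<in>Pow N. (\<Sum>X\<in>Pow N. \<Sum>Y\<in>Pow N. W X Y * (\<Prod>i<card D. pair_diff a b i X * pair_diff a b i Y)) / 2 ^ card D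
        * (c D * e D))"
  proof (intro sum.cong refl)
    fix D assume D: "D \<in> Pow N"
    show "newton_coeff (\<phi> (card D) (card D)) (card D) * c D * e D = (\<Sum>X\<in>Pow N. \<Sum>Y\<in>Pow N. W X Y * (\<Prod>i<card D. pair_diff a b i X * pair_diff a b i Y)) / 2 ^ card D
        * (c D * e D)"
    proof (cases "c D = 0")
      case False
      then have "card D \<le> K" using deg D by auto
      then have "disjoint_pairs N (card D) a b"
        by (rule disjoint_pairs_mono[OF pairs])
      from newton_eq_pair_diff[OF N q this] show ?thesis by simp
    qed simp
  qed
  finally show ?thesis .
qed

section \<open>Probability of splitting disjoint pairs of coordinates\<close>

definition splits :: "nat \<Rightarrow> (nat \<Rightarrow> 'a) \<Rightarrow> (nat \<Rightarrow> 'a) \<Rightarrow> 'a set \<Rightarrow> bool" where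
  "splits k a b X \<longleftrightarrow> (\<forall>i<k. (a i \<in> X) \<noteq> (b i \<in> X))"

lemma sum_Pow_card_binomial:
  assumes "finite N"
  shows "(\<Sum>X\<in>Pow N. g (card X)) = (\<Sum>j\<le>card N. real (card N choose j) * g j)"
proof -
  have "(\<Sum>X\<in>Pow N. g (card X)) = (\<Sum>j\<le>card N. \<Sum>X | X \<subseteq> N \<and> card X = j. g (card X))"
    by (rule sum_Pow_by_card[OF assms])
  also have "\<dots> = (\<Sum>j\<le>card N. real (card N choose j) * g j)"
    by (intro sum.cong refl) (simp add: n_subsets[OF assms])
  finally show ?thesis .
qed

lemma sum_splits_insert_pair:
  assumes "finite N" "u \<notin> N" "v \<notin> N" "u \<noteq> v"
  shows "(\<Sum>X\<in>Pow (insert u (insert v N)). if (u \<in> X) \<noteq> (v \<in> X) then f X else 0) =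
         (\<Sum>X\<in>Pow N. f (insert u X) + f (insert v X) :: real)"
proof -
  let ?h = "\<lambda>X. if (u \<in> X) \<noteq> (v \<in> X) then f X else 0"
  have Pow: "(\<Sum>X\<in>Pow (insert w M). g X) = (\<Sum>X\<in>Pow M. g X + g (insert w X) :: real)"
    if "finite M" "w \<notin> M" for w M g
  proof -
    have "Pow M \<inter> insert w ` Pow M = {}" "inj_on (insert w) (Pow M)"
      using that by (auto simp: inj_on_def)
    then show ?thesis
      using that(1) unfolding Pow_insert
      by (simp add: sum.union_disjoint sum.reindex sum.distrib)
  qed
  have "(\<Sum>X\<in>Pow (insert u (insert v N)). ?h X) =
      (\<Sum>X\<in>Pow N. ?h X + ?h (insert u X) + (?h (insert v X) + ?h (insert u (insert v X))))"
    using assms by (subst Pow, simp, simp, subst Pow) auto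
  also have "\<dots> = (\<Sum>X\<in>Pow N. f (insert u X) + f (insert v X))"
    by (rule sum.cong[OF refl]) (use assms in auto)
  finally show ?thesis .
qed

text \<open>
  A set that splits \<open>k\<close> disjoint pairs takes one of two elements from each of them, and is arbitrary
  on the remaining \<open>card N - 2 * k\<close> coordinates.
\<close>

lemma sum_splits:
  fixes g :: "nat \<Rightarrow> real"
  assumes "finite N" "disjoint_pairs N k a b"
  shows "(\<Sum>X\<in>Pow N. of_bool (splits k a b X) * g (card X)) =
     2 ^ k * (\<Sum>j\<le>card N - 2 * k. real ((card N - 2 * k) choose j) * g (k + j))"
  using assms
proof (induction k arbitrary: N g)
  case 0
  then show ?case by (simp add: splits_def sum_Pow_card_binomial)
next
  case (Suc k)
  let ?u = "a k" and ?v = "b k"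
  define N' where "N' = N - {?u, ?v}"
  have "?u \<in> a ` {..<Suc k}" "?v \<in> b ` {..<Suc k}" by auto
  then have uv: "?u \<in> N" "?v \<in> N" "?u \<noteq> ?v"
    using Suc.prems(2) unfolding disjoint_pairs_def by (blast, blast, metis IntI empty_iff)
  have N: "N = insert ?u (insert ?v N')" "?u \<notin> N'" "?v \<notin> N'" "finite N'"
    using uv Suc.prems(1) by (auto simp: N'_def)
  have ne: "a i \<noteq> ?u" "a i \<noteq> ?v" "b i \<noteq> ?u" "b i \<noteq> ?v" if "i < k" for i
  proof -
    have "a ` {..<Suc k} \<inter> b ` {..<Suc k} = {}" "inj_on a {..<Suc k}" "inj_on b {..<Suc k}"
      using Suc.prems(2) by (auto simp: disjoint_pairs_def)
    moreover have "i \<in> {..<Suc k}" "k \<in> {..<Suc k}" "i \<noteq> k" using that by auto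
    ultimately show "a i \<noteq> ?u" "a i \<noteq> ?v" "b i \<noteq> ?u" "b i \<noteq> ?v"
      by (metis inj_onD, metis IntI empty_iff imageI, metis IntI empty_iff imageI, metis inj_onD)
  qed
  have pairs: "disjoint_pairs N' k a b"
  proof -
    have "disjoint_pairs N k a b" using disjoint_pairs_mono[OF Suc.prems(2)] by simp
    moreover have "a ` {..<k} \<union> b ` {..<k} \<subseteq> N'"
    proof -
      have "a ` {..<k} \<union> b ` {..<k} \<subseteq> N" using calculation by (simp add: disjoint_pairs_def)
      then show ?thesis using ne by (auto simp: N'_def)
    qed
    ultimately show ?thesis by (simp add: disjoint_pairs_def)
  qed
  have card: "card N = card N' + 2" using N uv(3) by (subst N(1)) simp
  have "(\<Sum>X\<in>Pow N. of_bool (splits (Suc k) a b X) * g (card X))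
     = (\<Sum>X\<in>Pow N. if (?u \<in> X) \<noteq> (?v \<in> X) then of_bool (splits k a b X) * g (card X) else 0)"
    by (rule sum.cong[OF refl]) (auto simp: splits_def less_Suc_eq)
  also have "\<dots> = (\<Sum>X\<in>Pow N'. of_bool (splits k a b (insert ?u X)) * g (card (insert ?u X)) +
       of_bool (splits k a b (insert ?v X)) * g (card (insert ?v X)))"
    by (subst N(1), rule sum_splits_insert_pair) (use N uv in auto)
  also have "\<dots> = (\<Sum>X\<in>Pow N'. 2 * (of_bool (splits k a b X) * g (Suc (card X))))"
  proof (rule sum.cong[OF refl])
    fix X assume "X \<in> Pow N'"
    then have "?u \<notin> X" "?v \<notin> X" "finite X" using N finite_subset by auto
    then show "of_bool (splits k a b (insert ?u X)) * g (card (insert ?u X)) +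
       of_bool (splits k a b (insert ?v X)) * g (card (insert ?v X)) = 2 * (of_bool (splits k a b X) * g (Suc (card X)))"
      using ne by (simp add: splits_def)
  qed
  also have "\<dots> = 2 * (2 ^ k * (\<Sum>j\<le>card N' - 2 * k. real ((card N' - 2 * k) choose j) * g (Suc (k + j))))"
    unfolding sum_distrib_left[symmetric] using Suc.IH[OF N(4) pairs, of "\<lambda>j. g (Suc j)"] by simp
  finally show ?case using card by simp
qed

lemma disjoint_pairs_card:
  assumes "finite N" "disjoint_pairs N k a b"
  shows "2 * k \<le> card N"
proof -
  have "card (a ` {..<k} \<union> b ` {..<k}) = 2 * k"
    using assms(2) by (simp add: disjoint_pairs_def card_Un_disjoint card_image)
  moreover have "a ` {..<k} \<union> b ` {..<k} \<subseteq> N" using assms(2) by (simp add: disjoint_pairs_def)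
  ultimately show ?thesis using card_mono[OF assms(1)] by metis
qed

lemma central_binomial_Suc_le: "(2 * Suc m) choose (Suc m) \<le> 4 * ((2 * m) choose m)"
proof (cases m)
  case (Suc l)
  have "(2 * Suc m) choose (Suc m) = (2*m choose l) + 2 * (2*m choose m) + (2*m choose Suc m)"
    using Suc by simp
  also have "\<dots> \<le> 4 * (2 * m choose m)"
    using binomial_maximum'[of m l] binomial_maximum'[of m "Suc m"] by simp
  finally show ?thesis .
qed simp

lemma central_binomial_add_le: "(2 * (m + k)) choose (m + k) \<le> 4 ^ k * ((2 * m) choose m)"
proof (induction k)
  case (Suc k)
  then show ?case using central_binomial_Suc_le[of "m + k"] by simp
qed simp


text \<open>
  On the cube the probability is \<open>2 ^ (-k)\<close>. On the middle slice it is
  \<open>2 ^ k * ((2 * (m - k)) choose (m - k)) / ((2 * m) choose m)\<close>, and each step from \<open>m\<close> to \<open>m - 1\<close> divides the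
  central binomial coefficient by at most 4. Consequently the norm of a harmonic polynomial on the cube
  is at most its norm on the middle slice.
\<close>

lemma split_probability_cube_le_slice:
  assumes "finite N" "card N = 2 * m" "disjoint_pairs N k a b"
  shows "(\<Sum>X\<in>Pow N. of_bool (splits k a b X)) / 2 ^ card N \<le>
    (\<Sum>X\<in>Pow N. of_bool (splits k a b X \<and> card X = m)) / (real (card N choose m))"
proof -
  have km: "k \<le> m" using disjoint_pairs_card[OF assms(1,3)] assms(2) by simp
  have "(\<Sum>X\<in>Pow N. of_bool (splits k a b X)) = (2 ^ k * 2 ^ (2 * m - 2 * k) :: real)"
  proof -
    have "(\<Sum>X\<in>Pow N. of_bool (splits k a b X)) = 2 ^ k * (\<Sum>j\<le>2 * m - 2 * k. real ((2 * m - 2 * k) choose j))"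
      using sum_splits[OF assms(1,3), of "\<lambda>_. 1"] assms(2) by simp
    also have "\<dots> = 2 ^ k * real (\<Sum>j\<le>2 * m - 2 * k. (2 * m - 2 * k) choose j)" by simp
    finally show ?thesis by (simp only: choose_row_sum) simp
  qed
  then have cube: "(\<Sum>X\<in>Pow N. of_bool (splits k a b X)) / 2 ^ card N = (1::real) / 2 ^ k"
  proof -
    have "(2::real) ^ card N = 2 ^ k * 2 ^ k * 2 ^ (2 * m - 2 * k)"
      using km assms(2) by (simp flip: power_add)
    then show ?thesis using \<open>_ = 2 ^ k * 2 ^ (2 * m - 2 * k)\<close> by simp
  qed
  have "(\<Sum>X\<in>Pow N. of_bool (splits k a b X \<and> card X = m)) =
     (\<Sum>X\<in>Pow N. of_bool (splits k a b X) * (of_bool (card X = m) :: real))"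
    by (intro sum.cong) auto
  also have "\<dots> = 2 ^ k * (\<Sum>j\<le>2 * m - 2 * k. real ((2 * m - 2 * k) choose j) * of_bool (k + j = m))"
    using sum_splits[OF assms(1,3), of "\<lambda>j. of_bool (j = m)"] assms(2) by simp
  also have "(\<Sum>j\<le>2 * m - 2 * k. real ((2 * m - 2 * k) choose j) * of_bool (k + j = m))
     = (\<Sum>j\<le>2 * m - 2 * k. if j = m - k then real ((2 * m - 2 * k) choose j) else 0)"
    using km by (intro sum.cong) auto
  also have "\<dots> = real ((2 * (m - k)) choose (m - k))"
    using km by (simp add: diff_mult_distrib2)
  finally have slice: "(\<Sum>X\<in>Pow N. of_bool (splits k a b X \<and> card X = m)) = 2 ^ k * real ((2 * (m - k)) choose (m - k))" .
  have "real ((2 * m) choose m) \<le> 4 ^ k * real ((2 * (m - k)) choose (m - k))"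
  proof -
    have "(2 * m) choose m \<le> 4 ^ k * ((2 * (m - k)) choose (m - k))"
      using central_binomial_add_le[of "m - k" k] km by simp
    then have "real ((2 * m) choose m) \<le> real (4 ^ k * ((2 * (m - k)) choose (m - k)))"
      by (simp only: of_nat_le_iff)
    then show ?thesis by simp
  qed
  then have "1 / 2 ^ k \<le> 2 ^ k * real ((2 * (m - k)) choose (m - k)) / real ((2 * m) choose m)"
  proof -
    have four: "(4::real) ^ k = 2 ^ k * 2 ^ k" by (simp flip: power_mult_distrib)
    have "real ((2 * m) choose m) > 0" by simp
    then show ?thesis
      using \<open>real ((2 * m) choose m) \<le> _\<close> unfolding four
      by (subst le_divide_eq) (simp add: field_simps)
  qed
  then show ?thesis unfolding cube slice using assms(2) by simp
qed

section \<open>A monotone coupling of the cube and the middle slice\<close>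

definition partners :: "'a set \<Rightarrow> nat \<Rightarrow> 'a set \<Rightarrow> 'a set set" where
  "partners N m X = {Y. Y \<subseteq> N \<and> card Y = m \<and> (X \<subseteq> Y \<or> Y \<subseteq> X)}"

text \<open>
  The joint law of a uniform point \<open>X\<close> of the cube and a uniform choice of \<open>Y\<close> among the \<open>m\<close>-sets
  comparable with \<open>X\<close>. Comparability is essential: it makes the coordinate differences of \<open>X\<close> and \<open>Y\<close>
  agree in sign, so that their product counts the event that both points split the pair.
\<close>

definition coupling :: "'a set \<Rightarrow> nat \<Rightarrow> 'a set \<Rightarrow> 'a set \<Rightarrow> real" where
  "coupling N m X Y = of_bool (Y \<in> partners N m X) / (2 ^ card N * real (card (partners N m X)))"

lemma coupling_nonneg: "coupling N m X Y \<ge> 0"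
  by (simp add: coupling_def)

lemma coupling_nonzeroD:
  "coupling N m X Y \<noteq> 0 \<Longrightarrow> card Y = m \<and> (X \<subseteq> Y \<or> Y \<subseteq> X)"
  by (auto simp: coupling_def partners_def)

lemma finite_partners: "finite N \<Longrightarrow> finite (partners N m X)"
  by (rule finite_subset[of _ "Pow N"]) (auto simp: partners_def)

lemma partners_nonempty:
  assumes "finite N" "X \<subseteq> N" "m \<le> card N"
  shows "partners N m X \<noteq> {}"
proof (cases "m \<le> card X")
  case True
  then obtain Y where "Y \<subseteq> X" "card Y = m" by (metis obtain_subset_with_card_n)
  then show ?thesis using assms(2) by (auto simp: partners_def)
next
  case False
  then have "m - card X \<le> card (N - X)"
    using assms finite_subset[OF assms(2,1)] by (simp add: card_Diff_subset)
  then obtain Z where Z: "Z \<subseteq> N - X" "card Z = m - card X" by (metis obtain_subset_with_card_n)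
  have "card (X \<union> Z) = m"
    using Z False assms finite_subset[OF assms(2,1)] finite_subset[of Z N]
    by (subst card_Un_disjoint) auto
  then show ?thesis using Z assms(2) by (auto simp: partners_def)
qed

lemma coupling_marginal_cube:
  assumes "finite N" "X \<subseteq> N" "m \<le> card N"
  shows "(\<Sum>Y\<in>Pow N. coupling N m X Y) = 1 / 2 ^ card N"
proof -
  have "(\<Sum>Y\<in>Pow N. of_bool (Y \<in> partners N m X)) = real (card (partners N m X))"
  proof -
    have "{Y \<in> Pow N. Y \<in> partners N m X} = partners N m X" by (auto simp: partners_def)
    then show ?thesis using assms(1) by (simp add: of_bool_def sum.If_cases Int_def del: Pow_iff)
  qed
  moreover have "card (partners N m X) \<noteq> 0"
    using partners_nonempty[OF assms] finite_partners[OF assms(1)] by simp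
  ultimately show ?thesis
    unfolding coupling_def by (simp flip: sum_divide_distrib)
qed

lemma permutes_image_subset: "p permutes N \<Longrightarrow> X \<subseteq> N \<Longrightarrow> p ` X \<subseteq> N"
  by (metis image_mono permutes_image)

lemma perm_invariant_coupling: "perm_invariant N (coupling N m)"
  unfolding perm_invariant_def
proof (intro allI impI)
  fix p X Y assume p: "p permutes N" and sub: "X \<subseteq> N" "Y \<subseteq> N"
  have inj: "inj p" using permutes_inj[OF p] .
  have mem: "p ` Y \<in> partners N m (p ` X) \<longleftrightarrow> Y \<in> partners N m X" if "Y \<subseteq> N" for Y
    using that permutes_image_subset[OF p that]
    by (simp add: partners_def inj_image_subset_iff[OF inj] card_image inj_on_subset[OF inj])
  have "card (partners N m (p ` X)) = card (partners N m X)"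
  proof -
    have "bij_betw ((`) p) (Pow N) (Pow N)"
      using bij_betw_Pow permutes_imp_bij[OF p] by blast
    then have im: "(`) p ` Pow N = Pow N" and inj': "inj_on ((`) p) (Pow N)" by (auto simp: bij_betw_def)
    have "partners N m (p ` X) = (`) p ` partners N m X"
    proof (rule set_eqI)
      fix Z
      have sub': "Z \<subseteq> N" if "Z \<in> partners N m X'" for Z X' using that by (simp add: partners_def)
      show "Z \<in> partners N m (p ` X) \<longleftrightarrow> Z \<in> (`) p ` partners N m X"
      proof
        assume Z: "Z \<in> partners N m (p ` X)"
        then have "Z \<in> (`) p ` Pow N" unfolding im using sub' by blast
        then obtain Y where "Z = p ` Y" "Y \<subseteq> N" by blast
        then show "Z \<in> (`) p ` partners N m X" using Z mem by blast
      next
        assume "Z \<in> (`) p ` partners N m X"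
        then show "Z \<in> partners N m (p ` X)" using mem sub' by blast
      qed
    qed
    moreover have "inj_on ((`) p) (partners N m X)"
      by (rule inj_on_subset[OF inj']) (auto simp: partners_def)
    ultimately show ?thesis by (simp add: card_image)
  qed
  then show "coupling N m (p ` X) (p ` Y) = coupling N m X Y"
    using mem[OF sub(2)] by (simp add: coupling_def)
qed

lemma invariant_on_level_is_average:
  fixes g :: "'a set \<Rightarrow> real"
  assumes N: "finite N" and inv: "\<And>p Y. p permutes N \<Longrightarrow> Y \<subseteq> N \<Longrightarrow> card Y = m \<Longrightarrow> g (p ` Y) = g Y"
    and Y: "Y \<subseteq> N" "card Y = m"
  shows "g Y = (\<Sum>Z | Z \<subseteq> N \<and> card Z = m. g Z) / real (card N choose m)"
proof -
  have "g Z = g Y" if Z: "Z \<subseteq> N" "card Z = m" for Z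
  proof -
    obtain p where "p permutes N" "p ` Y = Z"
      using permutes_two_sets[OF N Y(1) Y(1) Z(1) Z(1)] Z(2) Y(2) by (metis Int_absorb)
    then show ?thesis using inv Y by metis
  qed
  then have "(\<Sum>Z | Z \<subseteq> N \<and> card Z = m. g Z) = real (card N choose m) * g Y"
    by (simp add: n_subsets[OF N])
  moreover have "m \<le> card N" using Y card_mono[OF N] by metis
  ultimately show ?thesis by simp
qed

text \<open>
  By invariance the left-hand side is the same for all \<open>m\<close>-sets \<open>Y\<close>, hence equals its average
  over them. For constant \<open>h\<close> this shows that the second marginal is uniform on the slice.
\<close>

lemma coupling_average_given_slice_point:
  assumes N: "finite N" "m \<le> card N" and h: "\<And>p X. p permutes N \<Longrightarrow> X \<subseteq> N \<Longrightarrow> h (p ` X) = h X"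
    and Y: "Y \<subseteq> N" "card Y = m"
  shows "(\<Sum>X\<in>Pow N. coupling N m X Y * h X) = (\<Sum>X\<in>Pow N. h X) / 2 ^ card N / real (card N choose m)"
proof -
  let ?g = "\<lambda>Y. \<Sum>X\<in>Pow N. coupling N m X Y * h X"
  have inv: "?g (p ` Y) = ?g Y" if "p permutes N" "Y \<subseteq> N" for p Y
  proof -
    have "?g (p ` Y) = (\<Sum>X\<in>Pow N. coupling N m (p ` X) (p ` Y) * h (p ` X))"
      by (rule sum_Pow_permutes[OF that(1), symmetric])
    also have "\<dots> = ?g Y"
      using perm_invariant_coupling[of N m] that h by (intro sum.cong) (auto simp: perm_invariant_def)
    finally show ?thesis .
  qed
  have "(\<Sum>Z | Z \<subseteq> N \<and> card Z = m. ?g Z) = (\<Sum>Z\<in>Pow N. ?g Z)"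
  proof (rule sum.mono_neutral_left)
    have "coupling N m X Z = 0" if "card Z \<noteq> m" for X Z using coupling_nonzeroD that by blast
    then show "\<forall>Z\<in>Pow N - {Z. Z \<subseteq> N \<and> card Z = m}. ?g Z = 0" by simp
  qed (use N in auto)
  also have "\<dots> = (\<Sum>X\<in>Pow N. (\<Sum>Z\<in>Pow N. coupling N m X Z) * h X)"
    by (subst sum.swap) (simp add: sum_distrib_right)
  also have "\<dots> = (\<Sum>X\<in>Pow N. h X) / 2 ^ card N"
    unfolding sum_divide_distrib
    by (intro sum.cong refl) (use coupling_marginal_cube[OF N(1) _ N(2)] in auto)
  finally show ?thesis
    using invariant_on_level_is_average[OF N(1) _ Y, of ?g] inv by simp
qed

lemma coupling_marginal_slice:
  assumes "finite N" "m \<le> card N" "Y \<subseteq> N"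
  shows "(\<Sum>X\<in>Pow N. coupling N m X Y) = of_bool (card Y = m) / real (card N choose m)"
proof (cases "card Y = m")
  case True
  then show ?thesis
    using coupling_average_given_slice_point[of N m "\<lambda>_. 1" Y] assms by (simp add: card_Pow)
next
  case False
  then show ?thesis using coupling_nonzeroD[of N m _ Y] by (auto intro!: sum.neutral)
qed


definition mean_gap :: "'a set \<Rightarrow> nat \<Rightarrow> real" where
  "mean_gap N m = (\<Sum>X\<in>Pow N. \<bar>real (card X) - real m\<bar>) / 2 ^ card N"

text \<open>
  The variance of a binomial variable: adding a coordinate replaces the deviation \<open>t\<close> by \<open>t + 1\<close>
  and \<open>t - 1\<close>, whose squares add up to \<open>2 * t^2 + 2\<close>.
\<close>

lemma sum_Pow_square_deviation:
  assumes "finite N"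
  shows "(\<Sum>X\<in>Pow N. (2 * real (card X) - real (card N))\<^sup>2) = real (card N) * 2 ^ card N"
  using assms
proof (induction N rule: finite_induct)
  case (insert x N)
  have disj: "Pow N \<inter> insert x ` Pow N = {}" "inj_on (insert x) (Pow N)"
    using insert.hyps by (auto simp: inj_on_def)
  have "(\<Sum>X\<in>Pow (insert x N). (2 * real (card X) - real (card (insert x N)))\<^sup>2)
    = (\<Sum>X\<in>Pow N. (2 * real (card X) - real (Suc (card N)))\<^sup>2 + (2 * real (card (insert x X)) - real (Suc (card N)))\<^sup>2)"
    using disj insert.hyps unfolding Pow_insert
    by (simp add: sum.union_disjoint sum.reindex sum.distrib)
  also have "\<dots> = (\<Sum>X\<in>Pow N. 2 * (2 * real (card X) - real (card N))\<^sup>2 + 2)"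
  proof (rule sum.cong[OF refl])
    fix X assume "X \<in> Pow N"
    then have "card (insert x X) = Suc (card X)"
      using insert.hyps finite_subset by (subst card_insert_disjoint) auto
    then show "(2 * real (card X) - real (Suc (card N)))\<^sup>2 + (2 * real (card (insert x X)) - real (Suc (card N)))\<^sup>2
      = 2 * (2 * real (card X) - real (card N))\<^sup>2 + 2"
      by (simp add: power2_eq_square algebra_simps)
  qed
  also have "\<dots> = 2 * (real (card N) * 2 ^ card N) + 2 * 2 ^ card N"
    using insert by (simp add: sum.distrib card_Pow flip: sum_distrib_left)
  finally show ?case using insert.hyps by (simp add: algebra_simps)
qed simp

lemma mean_gap_le:
  assumes "finite N" "card N = 2 * m"
  shows "mean_gap N m \<le> sqrt (real (card N)) / 2"
proof -
  let ?S = "\<Sum>X\<in>Pow N. \<bar>real (card X) - real m\<bar>"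
  have "?S\<^sup>2 \<le> (\<Sum>X\<in>Pow N. \<bar>real (card X) - real m\<bar>\<^sup>2) * (\<Sum>X\<in>Pow N. 1\<^sup>2)"
    using Cauchy_Schwarz_ineq_sum[of "\<lambda>X. \<bar>real (card X) - real m\<bar>" "\<lambda>_. 1" "Pow N"] by simp
  also have "(\<Sum>X\<in>Pow N. \<bar>real (card X) - real m\<bar>\<^sup>2) = (\<Sum>X\<in>Pow N. (2 * real (card X) - real (card N))\<^sup>2) / 4"
    unfolding sum_divide_distrib by (intro sum.cong refl) (simp add: assms(2) power2_eq_square field_simps)
  also have "\<dots> * (\<Sum>X\<in>Pow N. 1\<^sup>2) = (sqrt (real (card N)) / 2 * 2 ^ card N)\<^sup>2"
    using assms(1) by (simp add: sum_Pow_square_deviation card_Pow power_mult_distrib power_divide power2_eq_square[of "2 ^ _"])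
  finally have "?S \<le> sqrt (real (card N)) / 2 * 2 ^ card N"
    by (rule power2_le_imp_le) simp
  then show ?thesis unfolding mean_gap_def by (simp add: field_simps)
qed

text \<open>
  Transposing two coordinates on the same side of \<open>Y\<close> shows that the disagreement probability of a
  coordinate given \<open>Y\<close> depends only on whether it lies in \<open>Y\<close>. Both sides have \<open>m\<close> elements, so \<open>m\<close> times
  the left-hand side is the expected size of the symmetric difference of \<open>X\<close> and \<open>Y\<close>, and for comparable
  sets this size is the difference of cardinalities.
\<close>

lemma coupling_disagreement_pair:
  assumes N: "finite N" "card N = 2 * m" and Y: "Y \<subseteq> N" "card Y = m" "m > 0"
    and uv: "u \<in> Y" "v \<in> N - Y"
  shows "(\<Sum>X\<in>Pow N. coupling N m X Y * (of_bool (u \<notin> X) + of_bool (v \<in> X))) = mean_gap N m / (real m * real (card N choose m))"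
proof -
  define r where "r i = (\<Sum>X\<in>Pow N. coupling N m X Y * of_bool ((i \<in> X) \<noteq> (i \<in> Y)))" for i
  have r_eq: "r i = r j" if ij: "i \<in> N" "j \<in> N" "i \<in> Y \<longleftrightarrow> j \<in> Y" for i j
  proof -
    let ?t = "Transposition.transpose i j"
    have t: "?t permutes N" using ij by (simp add: permutes_swap_id)
    have tY: "?t ` Y = Y" using ij(3) by (auto simp: transpose_def image_iff)
    have "r i = (\<Sum>X\<in>Pow N. coupling N m (?t ` X) Y * of_bool ((i \<in> ?t ` X) \<noteq> (i \<in> Y)))"
      unfolding r_def by (rule sum_Pow_permutes[OF t, symmetric])
    also have "\<dots> = r j"
      unfolding r_def
    proof (intro sum.cong refl)
      fix X assume X: "X \<in> Pow N"
      have "coupling N m (?t ` X) (?t ` Y) = coupling N m X Y"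
        using perm_invariant_coupling[of N m] t X Y(1) by (auto simp: perm_invariant_def)
      moreover have "i \<in> ?t ` X \<longleftrightarrow> j \<in> X" by (simp add: in_transpose_image_iff)
      ultimately show "coupling N m (?t ` X) Y * of_bool ((i \<in> ?t ` X) \<noteq> (i \<in> Y)) = coupling N m X Y * of_bool ((j \<in> X) \<noteq> (j \<in> Y))"
        using tY ij(3) by simp
    qed
    finally show ?thesis .
  qed
  have fY: "finite Y" using Y N finite_subset by blast
  have "real m * (r u + r v) = (\<Sum>i\<in>Y. r u) + (\<Sum>i\<in>N - Y. r v)"
    using Y N fY by (simp add: card_Diff_subset algebra_simps)
  also have "\<dots> = (\<Sum>i\<in>Y. r i) + (\<Sum>i\<in>N - Y. r i)"
  proof -
    have "r u = r i" if "i \<in> Y" for i using r_eq[of u i] uv Y(1) that by auto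
    moreover have "r v = r i" if "i \<in> N - Y" for i using r_eq[of v i] uv that by auto
    ultimately show ?thesis by (intro arg_cong2[of _ _ _ _ "(+)"] sum.cong refl)
  qed
  also have "\<dots> = (\<Sum>i\<in>N. r i)"
    using sum.subset_diff[OF Y(1) N(1), of r] by simp
  also have "\<dots> = (\<Sum>X\<in>Pow N. \<Sum>i\<in>N. coupling N m X Y * of_bool ((i \<in> X) \<noteq> (i \<in> Y)))"
    unfolding r_def by (rule sum.swap)
  also have "\<dots> = (\<Sum>X\<in>Pow N. coupling N m X Y * \<bar>real (card X) - real m\<bar>)"
  proof (intro sum.cong refl)
    fix X assume X: "X \<in> Pow N"
    show "(\<Sum>i\<in>N. coupling N m X Y * of_bool ((i \<in> X) \<noteq> (i \<in> Y))) = coupling N m X Y * \<bar>real (card X) - real m\<bar>"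
    proof (cases "coupling N m X Y = 0")
      case False
      then have comp: "X \<subseteq> Y \<or> Y \<subseteq> X" using coupling_nonzeroD by blast
      have fX: "finite X" using X N finite_subset by blast
      have "(\<Sum>i\<in>N. of_bool ((i \<in> X) \<noteq> (i \<in> Y))) = real (card {i \<in> N. (i \<in> X) \<noteq> (i \<in> Y)})"
        using N(1) by (simp add: of_bool_def sum.If_cases Int_def)
      also have "\<dots> = \<bar>real (card X) - real m\<bar>"
        using comp
      proof
        assume "X \<subseteq> Y"
        moreover from this have "{i \<in> N. (i \<in> X) \<noteq> (i \<in> Y)} = Y - X" using Y by auto
        ultimately show ?thesis using fX fY Y(2) card_mono[OF fY \<open>X \<subseteq> Y\<close>] by (simp add: card_Diff_subset)
      next
        assume "Y \<subseteq> X"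
        moreover from this have "{i \<in> N. (i \<in> X) \<noteq> (i \<in> Y)} = X - Y" using X by auto
        ultimately show ?thesis using fX fY Y(2) card_mono[OF fX \<open>Y \<subseteq> X\<close>] by (simp add: card_Diff_subset)
      qed
      finally show ?thesis by (simp flip: sum_distrib_left)
    qed simp
  qed
  also have "\<dots> = mean_gap N m / real (card N choose m)"
    unfolding mean_gap_def
    by (rule coupling_average_given_slice_point)
      (use N Y in \<open>auto simp: card_image permutes_inj_on\<close>)
  finally have "real m * (r u + r v) = mean_gap N m / real (card N choose m)" .
  moreover have "r u + r v = real m * (r u + r v) / real m" using Y(3) by simp
  ultimately have "r u + r v = mean_gap N m / real (card N choose m) / real m" by metis
  then have "r u + r v = mean_gap N m / (real m * real (card N choose m))"
    by (simp add: mult.commute)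
  moreover have "r u + r v = (\<Sum>X\<in>Pow N. coupling N m X Y * (of_bool (u \<notin> X) + of_bool (v \<in> X)))"
    unfolding r_def sum.distrib[symmetric] using uv by (intro sum.cong) (auto simp: algebra_simps)
  ultimately show ?thesis by simp
qed

section \<open>Mean square distance between the coupled values\<close>

lemma comparable_pair_diff:
  assumes "X \<subseteq> Y \<or> Y \<subseteq> X"
  shows "pair_diff a b i X * pair_diff a b i Y = of_bool ((a i \<in> X) \<noteq> (b i \<in> X) \<and> (a i \<in> Y) \<noteq> (b i \<in> Y))"
  using assms by (auto simp: pair_diff_def)

text \<open>
  For comparable points the product is the indicator that both split all pairs. If \<open>Y\<close> splits them
  and \<open>X\<close> does not, then \<open>X\<close> and \<open>Y\<close> disagree somewhere on one of the pairs; the union bound over the \<open>k\<close> pairs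
  costs a factor \<open>1 - k * mean_gap N m / m\<close>.
\<close>

lemma split_correlation_lower_bound:
  assumes N: "finite N" "card N = 2 * m" "m > 0" and pairs: "disjoint_pairs N k a b"
  shows "(\<Sum>X\<in>Pow N. \<Sum>Y\<in>Pow N. coupling N m X Y * (\<Prod>i<k. pair_diff a b i X * pair_diff a b i Y))
    \<ge> (1 - real k * mean_gap N m / real m) * ((\<Sum>Y\<in>Pow N. of_bool (splits k a b Y \<and> card Y = m)) / real (card N choose m))"
proof -
  let ?C = "real (card N choose m)" and ?W = "coupling N m"
  let ?dis = "\<lambda>i X Y. of_bool ((a i \<in> X) \<noteq> (a i \<in> Y)) + of_bool ((b i \<in> X) \<noteq> (b i \<in> Y)) :: real"
  have mN: "m \<le> card N" using N by simp
  have pt: "?W X Y * (\<Prod>i<k. pair_diff a b i X * pair_diff a b i Y) \<ge>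
      of_bool (splits k a b Y \<and> card Y = m) * (?W X Y - (\<Sum>i<k. ?W X Y * ?dis i X Y))" for X Y
  proof (cases "?W X Y = 0")
    case False
    then have "card Y = m" and comp: "X \<subseteq> Y \<or> Y \<subseteq> X" using coupling_nonzeroD by blast+
    have prod: "(\<Prod>i<k. pair_diff a b i X * pair_diff a b i Y) = of_bool (\<forall>i<k. (a i \<in> X) \<noteq> (b i \<in> X) \<and> (a i \<in> Y) \<noteq> (b i \<in> Y))"
      by (subst comparable_pair_diff[OF comp], subst prod_of_bool) auto
    have "of_bool (splits k a b Y) * (1 - (\<Sum>i<k. ?dis i X Y)) \<le> (\<Prod>i<k. pair_diff a b i X * pair_diff a b i Y)"
    proof (cases "\<exists>i<k. ?dis i X Y \<ge> 1")
      case True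
      then obtain i where "i < k" "?dis i X Y \<ge> 1" by blast
      moreover from this have "?dis i X Y \<le> (\<Sum>i<k. ?dis i X Y)"
        by (intro member_le_sum) auto
      ultimately have "1 - (\<Sum>i<k. ?dis i X Y) \<le> 0" by linarith
      then show ?thesis unfolding prod by (auto simp: of_bool_def)
    next
      case False
      then have "(a i \<in> X) = (a i \<in> Y)" "(b i \<in> X) = (b i \<in> Y)" if "i < k" for i
        using that by (auto simp: not_le of_bool_def split: if_splits)
      then show ?thesis unfolding prod splits_def by (auto simp: sum_nonneg)
    qed
    then have "?W X Y * (of_bool (splits k a b Y) * (1 - (\<Sum>i<k. ?dis i X Y))) \<le> ?W X Y * (\<Prod>i<k. pair_diff a b i X * pair_diff a b i Y)"
      by (rule mult_left_mono) (rule coupling_nonneg)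
    then show ?thesis using \<open>card Y = m\<close> by (simp add: algebra_simps sum_distrib_left sum.distrib of_bool_conj)
  qed simp
  have cond: "(\<Sum>X\<in>Pow N. ?W X Y - (\<Sum>i<k. ?W X Y * ?dis i X Y)) = (1 - real k * mean_gap N m / real m) / ?C"
    if Y: "Y \<subseteq> N" "card Y = m" and sp: "splits k a b Y" for Y
  proof -
    have one: "(\<Sum>X\<in>Pow N. ?W X Y * ?dis i X Y) = mean_gap N m / (real m * ?C)" if i: "i < k" for i
    proof -
      have "a i \<in> N" "b i \<in> N" using pairs i by (auto simp: disjoint_pairs_def)
      then consider "a i \<in> Y" "b i \<in> N - Y" | "b i \<in> Y" "a i \<in> N - Y"
        using sp i by (auto simp: splits_def)
      then show ?thesis
      proof cases
        case 1
        from coupling_disagreement_pair[OF N(1,2) Y N(3) 1] show ?thesis using 1 by simp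
      next
        case 2
        from coupling_disagreement_pair[OF N(1,2) Y N(3) 2] show ?thesis using 2 by (simp add: add.commute)
      qed
    qed
    have "(\<Sum>X\<in>Pow N. ?W X Y - (\<Sum>i<k. ?W X Y * ?dis i X Y)) = 1 / ?C - (\<Sum>i<k. \<Sum>X\<in>Pow N. ?W X Y * ?dis i X Y)"
      unfolding sum_subtractf coupling_marginal_slice[OF N(1) mN Y(1)] using Y(2)
      by (subst sum.swap) simp
    also have "(\<Sum>i<k. \<Sum>X\<in>Pow N. ?W X Y * ?dis i X Y) = real k * (mean_gap N m / (real m * ?C))"
      using one by simp
    also have "1 / ?C - \<dots> = (1 - real k * mean_gap N m / real m) / ?C"
      by (simp add: diff_divide_distrib)
    finally show ?thesis .
  qed
  have "(1 - real k * mean_gap N m / real m) * ((\<Sum>Y\<in>Pow N. of_bool (splits k a b Y \<and> card Y = m)) / ?C)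
     = (\<Sum>Y\<in>Pow N. of_bool (splits k a b Y \<and> card Y = m) * ((1 - real k * mean_gap N m / real m) / ?C))"
    unfolding sum_distrib_right[symmetric] by (simp only: times_divide_eq_right times_divide_eq_left mult.commute)
  also have "\<dots> = (\<Sum>Y\<in>Pow N. of_bool (splits k a b Y \<and> card Y = m) * (\<Sum>X\<in>Pow N. ?W X Y - (\<Sum>i<k. ?W X Y * ?dis i X Y)))"
    using cond by (intro sum.cong refl) auto
  also have "\<dots> = (\<Sum>X\<in>Pow N. \<Sum>Y\<in>Pow N. of_bool (splits k a b Y \<and> card Y = m) * (?W X Y - (\<Sum>i<k. ?W X Y * ?dis i X Y)))"
    by (subst sum.swap) (simp only: sum_distrib_left)
  also have "\<dots> \<le> (\<Sum>X\<in>Pow N. \<Sum>Y\<in>Pow N. ?W X Y * (\<Prod>i<k. pair_diff a b i X * pair_diff a b i Y))"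
    by (intro sum_mono pt)
  finally show ?thesis .
qed

definition slice_avg :: "'a set \<Rightarrow> nat \<Rightarrow> ('a set \<Rightarrow> real) \<Rightarrow> real" where
  "slice_avg N m g = (\<Sum>Y | Y \<subseteq> N \<and> card Y = m. g Y) / real (card N choose m)"

definition cube_avg :: "'a set \<Rightarrow> ('a set \<Rightarrow> real) \<Rightarrow> real" where
  "cube_avg N g = (\<Sum>X\<in>Pow N. g X) / 2 ^ card N"

lemma perm_invariant_diagonal:
  assumes "\<And>p X. p permutes N \<Longrightarrow> X \<subseteq> N \<Longrightarrow> w (p ` X) = w X"
  shows "perm_invariant N (\<lambda>X Y. of_bool (X = Y) * w X)"
  using assms unfolding perm_invariant_def by (auto simp: inj_image_eq_iff permutes_inj)

lemma pair_diff_square: "(\<Prod>i<k. pair_diff a b i X * pair_diff a b i X) = of_bool (splits k a b X)"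
proof -
  have "(\<Prod>i<k. pair_diff a b i X * pair_diff a b i X) = (\<Prod>i<k. of_bool ((a i \<in> X) \<noteq> (b i \<in> X)))"
    by (rule prod.cong) (auto simp: pair_diff_def)
  then show ?thesis by (simp add: prod_of_bool splits_def Ball_def)
qed

text \<open>
  A single random point with weight \<open>w\<close>, seen as a pair of equal points.
\<close>

lemma weighted_form_diagonal:
  assumes N: "finite N" and w: "\<And>p X. p permutes N \<Longrightarrow> X \<subseteq> N \<Longrightarrow> w (p ` X) = w X"
    and c: "coeff_harmonic N c" and e: "coeff_harmonic N e"
    and pairs: "disjoint_pairs N K a b" and deg: "\<And>A. A \<subseteq> N \<Longrightarrow> c A \<noteq> 0 \<Longrightarrow> card A \<le> K"
  shows "(\<Sum>X\<in>Pow N. w X * (mlin N c X * mlin N e X)) =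
     (\<Sum>D\<in>Pow N. (\<Sum>X\<in>Pow N. of_bool (splits (card D) a b X) * w X) / 2 ^ card D * (c D * e D))"
proof -
  have diag: "(\<Sum>Y\<in>Pow N. of_bool (X = Y) * w X * g Y) = w X * (g X :: real)" if "X \<in> Pow N" for X g
  proof -
    have "(\<Sum>Y\<in>Pow N. of_bool (X = Y) * w X * g Y) = (\<Sum>Y\<in>Pow N. if X = Y then w X * g Y else 0)"
      by (intro sum.cong) auto
    then show ?thesis using that N by simp
  qed
  have "(\<Sum>X\<in>Pow N. w X * (mlin N c X * mlin N e X))
      = (\<Sum>X\<in>Pow N. \<Sum>Y\<in>Pow N. of_bool (X = Y) * w X * mlin N c X * mlin N e Y)"
    by (intro sum.cong refl) (simp add: diag[of _ "\<lambda>Y. mlin N c _ * mlin N e Y", symmetric] mult.assoc)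
  also have "\<dots> = (\<Sum>D\<in>Pow N. (\<Sum>X\<in>Pow N. \<Sum>Y\<in>Pow N. of_bool (X = Y) * w X * (\<Prod>i<card D. pair_diff a b i X * pair_diff a b i Y)) / 2 ^ card D
        * (c D * e D))"
    by (rule invariant_form_diagonal[OF N perm_invariant_diagonal c e pairs deg]) (use w in auto)
  also have "\<dots> = (\<Sum>D\<in>Pow N. (\<Sum>X\<in>Pow N. of_bool (splits (card D) a b X) * w X) / 2 ^ card D * (c D * e D))"
    by (intro sum.cong refl arg_cong2[of _ _ _ _ "(*)"] arg_cong2[of _ _ _ _ "(/)"])
      (simp only: diag pair_diff_square, rule mult.commute)
  finally show ?thesis .
qed

lemma sum_level_eq:
  assumes "finite N"
  shows "(\<Sum>Y | Y \<subseteq> N \<and> card Y = m. g Y) = (\<Sum>Y\<in>Pow N. of_bool (card Y = m) * (g Y :: real))"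
  by (rule sum.mono_neutral_cong_left) (use assms in auto)

lemma coupling_sum_cube:
  assumes "finite N" "m \<le> card N"
  shows "(\<Sum>X\<in>Pow N. \<Sum>Y\<in>Pow N. coupling N m X Y * g X) = cube_avg N g"
  unfolding cube_avg_def sum_distrib_right[symmetric] sum_divide_distrib
  by (intro sum.cong refl) (simp add: coupling_marginal_cube[OF assms(1) _ assms(2)])

lemma coupling_sum_slice:
  assumes "finite N" "m \<le> card N"
  shows "(\<Sum>X\<in>Pow N. \<Sum>Y\<in>Pow N. coupling N m X Y * g Y) = slice_avg N m g"
  unfolding slice_avg_def sum_level_eq[OF assms(1)] sum_divide_distrib
  by (subst sum.swap, unfold sum_distrib_right[symmetric], intro sum.cong refl)
    (simp add: coupling_marginal_slice[OF assms])

text \<open>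
  In degree \<open>k\<close> the mean square of the difference is the norm on the cube plus the norm on the slice
  minus twice the correlation. The first is at most the second, and the correlation is at least the
  second up to the factor \<open>1 - k * mean_gap N m / m\<close>. The constant term does not contribute, so what remains
  on the right is the variance on the slice rather than the second moment.
\<close>

lemma coupling_mean_square_le:
  assumes N: "finite N" "card N = 2 * m" "m > 0" and c: "coeff_harmonic N c"
    and pairs: "disjoint_pairs N K a b" and deg: "\<And>A. A \<subseteq> N \<Longrightarrow> c A \<noteq> 0 \<Longrightarrow> card A \<le> K"
  shows "(\<Sum>X\<in>Pow N. \<Sum>Y\<in>Pow N. coupling N m X Y * (mlin N c X - mlin N c Y)\<^sup>2)
    \<le> 2 * real K * mean_gap N m / real m * (slice_avg N m (\<lambda>X. (mlin N c X)\<^sup>2) - (slice_avg N m (mlin N c))\<^sup>2)"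
proof -
  let ?C = "real (card N choose m)" and ?W = "coupling N m" and ?F = "mlin N c"
  have mN: "m \<le> card N" using N by simp
  have C0: "?C > 0" using mN by simp
  \<comment> \<open>The sums below, divided by \<open>2 ^ k\<close>, are the scalars by which the cube, the slice and the
    coupling act in degree \<open>k\<close>.\<close>
  define Sc where "Sc k = (\<Sum>X\<in>Pow N. of_bool (splits k a b X)) / (2 ^ card N :: real)" for k
  define Ss where "Ss k = (\<Sum>X\<in>Pow N. of_bool (splits k a b X \<and> card X = m)) / ?C" for k
  define Sw where "Sw k = (\<Sum>X\<in>Pow N. \<Sum>Y\<in>Pow N. ?W X Y * (\<Prod>i<k. pair_diff a b i X * pair_diff a b i Y))" for k
  let ?\<theta> = "mean_gap N m / real m"
  have "mean_gap N m \<ge> 0" unfolding mean_gap_def by (intro divide_nonneg_nonneg sum_nonneg) auto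
  then have \<theta>: "?\<theta> \<ge> 0" by simp
  have Ss0: "Ss k \<ge> 0" for k unfolding Ss_def by (intro divide_nonneg_nonneg sum_nonneg) auto
  have slice: "slice_avg N m (\<lambda>X. ?F X * mlin N e X) = (\<Sum>D\<in>Pow N. Ss (card D) / 2 ^ card D * (c D * e D))"
    if "coeff_harmonic N e" for e
  proof -
    have "slice_avg N m (\<lambda>X. ?F X * mlin N e X) = (\<Sum>X\<in>Pow N. (of_bool (card X = m) / ?C) * (?F X * mlin N e X))"
      unfolding slice_avg_def sum_level_eq[OF N(1)] sum_divide_distrib by simp
    also have "\<dots> = (\<Sum>D\<in>Pow N. (\<Sum>X\<in>Pow N. of_bool (splits (card D) a b X) * (of_bool (card X = m) / ?C)) / 2 ^ card D * (c D * e D))"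
      by (rule weighted_form_diagonal[OF N(1) _ c that pairs deg]) (simp_all add: card_image permutes_inj_on)
    also have "\<dots> = (\<Sum>D\<in>Pow N. Ss (card D) / 2 ^ card D * (c D * e D))"
      unfolding Ss_def sum_divide_distrib by (simp add: of_bool_conj)
    finally show ?thesis .
  qed
  have cube: "cube_avg N (\<lambda>X. (?F X)\<^sup>2) = (\<Sum>D\<in>Pow N. Sc (card D) / 2 ^ card D * (c D)\<^sup>2)"
  proof -
    have "cube_avg N (\<lambda>X. (?F X)\<^sup>2) = (\<Sum>X\<in>Pow N. (1 / 2 ^ card N) * (?F X * ?F X))"
      unfolding cube_avg_def sum_divide_distrib by (simp add: power2_eq_square)
    also have "\<dots> = (\<Sum>D\<in>Pow N. (\<Sum>X\<in>Pow N. of_bool (splits (card D) a b X) * (1 / 2 ^ card N)) / 2 ^ card D * (c D * c D))"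
      by (rule weighted_form_diagonal[OF N(1) _ c c pairs deg]) simp_all
    also have "\<dots> = (\<Sum>D\<in>Pow N. Sc (card D) / 2 ^ card D * (c D)\<^sup>2)"
      unfolding Sc_def sum_divide_distrib by (simp add: power2_eq_square)
    finally show ?thesis .
  qed
  have cross: "(\<Sum>X\<in>Pow N. \<Sum>Y\<in>Pow N. ?W X Y * ?F X * ?F Y) = (\<Sum>D\<in>Pow N. Sw (card D) / 2 ^ card D * (c D)\<^sup>2)"
    unfolding Sw_def power2_eq_square
    by (rule invariant_form_diagonal[OF N(1) perm_invariant_coupling c c pairs deg])
  \<comment> \<open>The constant polynomial 1, used to identify the mean on the slice as the constant term.\<close>
  define e where "e A = (if A = {} then 1 else 0 :: real)" for A :: "'a set"
  have e: "coeff_harmonic N e" by (simp add: coeff_harmonic_def e_def)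
  have "mlin N e X = 1" for X
  proof -
    have "mlin N e X = (\<Sum>A\<in>Pow N. if A = {} then 1 else 0)"
      unfolding mlin_def by (intro sum.cong) (auto simp: e_def)
    then show ?thesis using N(1) by simp
  qed
  then have "slice_avg N m ?F = (\<Sum>D\<in>Pow N. Ss (card D) / 2 ^ card D * (c D * e D))"
    using slice[OF e] by simp
  also have "\<dots> = (\<Sum>D\<in>Pow N. if D = {} then Ss 0 * c {} else 0)"
    by (intro sum.cong) (auto simp: e_def)
  also have "\<dots> = Ss 0 * c {}" using N(1) by simp
  also have "Ss 0 = 1"
  proof -
    have "(\<Sum>Y\<in>Pow N. of_bool (card Y = m)) = ?C"
      using sum_level_eq[OF N(1), where m = m and g = "\<lambda>_. 1"] by (simp add: n_subsets[OF N(1)])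
    then show ?thesis using C0 by (simp add: Ss_def splits_def)
  qed
  finally have mean: "slice_avg N m ?F = c {}" by simp
  have var: "slice_avg N m (\<lambda>X. (?F X)\<^sup>2) - (slice_avg N m ?F)\<^sup>2 = (\<Sum>D\<in>Pow N - {{}}. Ss (card D) / 2 ^ card D * (c D)\<^sup>2)"
  proof -
    have "slice_avg N m (\<lambda>X. (?F X)\<^sup>2) = (\<Sum>D\<in>Pow N. Ss (card D) / 2 ^ card D * (c D)\<^sup>2)"
      using slice[OF c] by (simp add: power2_eq_square)
    also have "\<dots> = (c {})\<^sup>2 + (\<Sum>D\<in>Pow N - {{}}. Ss (card D) / 2 ^ card D * (c D)\<^sup>2)"
      using N(1) by (subst sum.remove[of _ "{}"]) (auto simp: \<open>Ss 0 = 1\<close>)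
    finally show ?thesis using mean by simp
  qed
  have "(\<Sum>X\<in>Pow N. \<Sum>Y\<in>Pow N. ?W X Y * (?F X - ?F Y)\<^sup>2) =
     (\<Sum>X\<in>Pow N. \<Sum>Y\<in>Pow N. ?W X Y * (?F X)\<^sup>2 + ?W X Y * (?F Y)\<^sup>2 - 2 * (?W X Y * ?F X * ?F Y))"
    by (intro sum.cong refl) (simp add: power2_eq_square algebra_simps)
  also have "\<dots> = (\<Sum>D\<in>Pow N. Sc (card D) / 2 ^ card D * (c D)\<^sup>2) + (\<Sum>D\<in>Pow N. Ss (card D) / 2 ^ card D * (c D)\<^sup>2)
      - 2 * (\<Sum>D\<in>Pow N. Sw (card D) / 2 ^ card D * (c D)\<^sup>2)"
    using coupling_sum_cube[OF N(1) mN, of "\<lambda>X. (?F X)\<^sup>2"] coupling_sum_slice[OF N(1) mN, of "\<lambda>X. (?F X)\<^sup>2"]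
      cube cross slice[OF c]
    by (simp add: sum.distrib sum_subtractf power2_eq_square flip: sum_distrib_left)
  also have "\<dots> = (\<Sum>D\<in>Pow N. (Sc (card D) + Ss (card D) - 2 * Sw (card D)) / 2 ^ card D * (c D)\<^sup>2)"
    by (simp add: sum.distrib sum_subtractf sum_distrib_left algebra_simps add_divide_distrib diff_divide_distrib)
  also have "\<dots> \<le> (\<Sum>D\<in>Pow N. if D = {} then 0 else 2 * real K * ?\<theta> * (Ss (card D) / 2 ^ card D * (c D)\<^sup>2))"
  proof (rule sum_mono)
    fix D assume D: "D \<in> Pow N"
    show "(Sc (card D) + Ss (card D) - 2 * Sw (card D)) / 2 ^ card D * (c D)\<^sup>2 \<le>
        (if D = {} then 0 else 2 * real K * ?\<theta> * (Ss (card D) / 2 ^ card D * (c D)\<^sup>2))"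
    proof (cases "c D = 0")
      case False
      let ?k = "card D"
      have kK: "?k \<le> K" using deg D False by auto
      have pk: "disjoint_pairs N ?k a b" by (rule disjoint_pairs_mono[OF pairs kK])
      have "Sc ?k \<le> Ss ?k"
        unfolding Sc_def Ss_def by (rule split_probability_cube_le_slice[OF N(1,2) pk])
      moreover have "Sw ?k \<ge> (1 - real ?k * ?\<theta>) * Ss ?k"
        unfolding Sw_def Ss_def using split_correlation_lower_bound[OF N pk] by simp
      ultimately have b: "Sc ?k + Ss ?k - 2 * Sw ?k \<le> 2 * real ?k * ?\<theta> * Ss ?k"
        unfolding left_diff_distrib mult.assoc by linarith
      have fac: "0 \<le> (c D)\<^sup>2 / 2 ^ ?k" by simp
      have "(Sc ?k + Ss ?k - 2 * Sw ?k) * ((c D)\<^sup>2 / 2 ^ ?k) \<le> 2 * real ?k * ?\<theta> * Ss ?k * ((c D)\<^sup>2 / 2 ^ ?k)"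
        by (rule mult_right_mono[OF b fac])
      moreover have "2 * real ?k * ?\<theta> * Ss ?k * ((c D)\<^sup>2 / 2 ^ ?k) \<le> 2 * real K * ?\<theta> * Ss ?k * ((c D)\<^sup>2 / 2 ^ ?k)"
        by (intro mult_right_mono fac Ss0 \<theta>) (use kK in simp)
      moreover have "?k = 0" if "D = {}" using that by simp
      ultimately show ?thesis by auto
    qed simp
  qed
  also have "\<dots> = 2 * real K * ?\<theta> * (\<Sum>D\<in>Pow N - {{}}. Ss (card D) / 2 ^ card D * (c D)\<^sup>2)"
    unfolding sum_distrib_left
    by (rule sum.mono_neutral_cong_right) (use N(1) in auto)
  finally show ?thesis unfolding var by simp
qed

section \<open>From mean square to Lipschitz test functions and distribution functions\<close>

lemma coupling_total:
  assumes "finite N" "m \<le> card N"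
  shows "(\<Sum>X\<in>Pow N. \<Sum>Y\<in>Pow N. coupling N m X Y) = 1"
  using coupling_sum_cube[OF assms, of "\<lambda>_. 1"] assms(1) by (simp add: cube_avg_def card_Pow)

lemma lipschitz_averages_close:
  fixes \<phi> :: "real \<Rightarrow> real"
  assumes N: "finite N" "m \<le> card N" and lip: "1-lipschitz_on UNIV \<phi>" and \<eta>: "\<eta> > 0"
    and ms: "(\<Sum>X\<in>Pow N. \<Sum>Y\<in>Pow N. coupling N m X Y * (F X - F Y)\<^sup>2) \<le> \<eta>\<^sup>2"
  shows "\<bar>slice_avg N m (\<lambda>X. \<phi> (F X)) - cube_avg N (\<lambda>X. \<phi> (F X))\<bar> \<le> 2 * \<eta>"
proof -
  let ?W = "coupling N m"
  have pt: "\<bar>?W X Y * \<phi> (F Y) - ?W X Y * \<phi> (F X)\<bar> \<le> ?W X Y * (F X - F Y)\<^sup>2 / \<eta> + \<eta> * ?W X Y" for X Y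
  proof -
    have "\<bar>\<phi> (F Y) - \<phi> (F X)\<bar> \<le> \<bar>F X - F Y\<bar>"
      using lipschitz_onD[OF lip, of "F Y" "F X"] by (simp add: dist_real_def abs_minus_commute)
    \<comment> \<open>This bound is linear in the square, so that summation over the coupling yields the mean square.\<close>
    also have "\<dots> \<le> (F X - F Y)\<^sup>2 / \<eta> + \<eta>"
    proof (cases "\<bar>F X - F Y\<bar> \<le> \<eta>")
      case False
      then have "\<bar>F X - F Y\<bar> * \<eta> \<le> \<bar>F X - F Y\<bar> * \<bar>F X - F Y\<bar>" by (intro mult_left_mono) auto
      then have "\<bar>F X - F Y\<bar> \<le> (F X - F Y)\<^sup>2 / \<eta>"
        using \<eta> by (simp add: field_simps power2_eq_square)
      then show ?thesis using \<eta> by simp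
    next
      case True
      moreover have "0 \<le> (F X - F Y)\<^sup>2 / \<eta>" using \<eta> by simp
      ultimately show ?thesis by linarith
    qed
    finally have "?W X Y * \<bar>\<phi> (F Y) - \<phi> (F X)\<bar> \<le> ?W X Y * ((F X - F Y)\<^sup>2 / \<eta> + \<eta>)"
      by (rule mult_left_mono[OF _ coupling_nonneg])
    moreover have "\<bar>?W X Y * \<phi> (F Y) - ?W X Y * \<phi> (F X)\<bar> = ?W X Y * \<bar>\<phi> (F Y) - \<phi> (F X)\<bar>"
      using coupling_nonneg[of N m X Y] by (simp add: abs_mult flip: right_diff_distrib)
    ultimately show ?thesis by (simp add: algebra_simps)
  qed
  have "\<bar>slice_avg N m (\<lambda>X. \<phi> (F X)) - cube_avg N (\<lambda>X. \<phi> (F X))\<bar>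
      = \<bar>\<Sum>X\<in>Pow N. \<Sum>Y\<in>Pow N. ?W X Y * \<phi> (F Y) - ?W X Y * \<phi> (F X)\<bar>"
    by (simp add: sum_subtractf coupling_sum_cube[OF N] coupling_sum_slice[OF N, of "\<lambda>X. \<phi> (F X)"])
  also have "\<dots> \<le> (\<Sum>X\<in>Pow N. \<Sum>Y\<in>Pow N. \<bar>?W X Y * \<phi> (F Y) - ?W X Y * \<phi> (F X)\<bar>)"
    by (rule order_trans[OF sum_abs]) (intro sum_mono sum_abs)
  also have "\<dots> \<le> (\<Sum>X\<in>Pow N. \<Sum>Y\<in>Pow N. ?W X Y * (F X - F Y)\<^sup>2 / \<eta> + \<eta> * ?W X Y)"
    by (intro sum_mono pt)
  also have "\<dots> = (\<Sum>X\<in>Pow N. \<Sum>Y\<in>Pow N. ?W X Y * (F X - F Y)\<^sup>2) / \<eta> + \<eta>"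
    using coupling_total[OF N] by (simp add: sum.distrib flip: sum_divide_distrib sum_distrib_left)
  also have "\<dots> \<le> \<eta>\<^sup>2 / \<eta> + \<eta>"
    using ms \<eta> by (intro add_right_mono divide_right_mono) auto
  also have "\<dots> = 2 * \<eta>" using \<eta> by (simp add: power2_eq_square)
  finally show ?thesis .
qed

text \<open>
  If one value is at most \<open>t - \<eta>\<close> or \<open>t\<close> and the other exceeds \<open>t\<close> or \<open>t + \<eta>\<close>, respectively, the two
  differ by at least \<open>\<eta>\<close>, and by Markov's inequality this has probability at most \<open>\<eta> ^ 3 / \<eta>\<^sup>2 = \<eta>\<close>.
\<close>

lemma coupled_distribution_functions:
  assumes N: "finite N" "m \<le> card N" and \<eta>: "\<eta> > 0"
    and ms: "(\<Sum>X\<in>Pow N. \<Sum>Y\<in>Pow N. coupling N m X Y * (F X - F Y)\<^sup>2) \<le> \<eta> ^ 3"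
  shows "cube_avg N (\<lambda>X. of_bool (F X \<le> t - \<eta>)) - \<eta> \<le> slice_avg N m (\<lambda>X. of_bool (F X \<le> t))"
    and "slice_avg N m (\<lambda>X. of_bool (F X \<le> t)) \<le> cube_avg N (\<lambda>X. of_bool (F X \<le> t + \<eta>)) + \<eta>"
proof -
  let ?W = "coupling N m"
  let ?M = "\<Sum>X\<in>Pow N. \<Sum>Y\<in>Pow N. ?W X Y * (F X - F Y)\<^sup>2 / \<eta>\<^sup>2"
  have "?M = (\<Sum>X\<in>Pow N. \<Sum>Y\<in>Pow N. ?W X Y * (F X - F Y)\<^sup>2) / \<eta>\<^sup>2"
    by (simp flip: sum_divide_distrib)
  also have "\<dots> \<le> \<eta> ^ 3 / \<eta>\<^sup>2" by (intro divide_right_mono ms) simp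
  also have "\<dots> = \<eta>" using \<eta> by (simp add: power2_eq_square power3_eq_cube)
  finally have M: "?M \<le> \<eta>" .
  have one: "1 \<le> (F X - F Y)\<^sup>2 / \<eta>\<^sup>2" if "\<bar>F X - F Y\<bar> \<ge> \<eta>" for X Y
    using power_mono[OF that, of 2] \<eta> by simp
  have pt: "?W X Y * of_bool (F X \<le> t - \<eta>) \<le> ?W X Y * of_bool (F Y \<le> t) + ?W X Y * (F X - F Y)\<^sup>2 / \<eta>\<^sup>2"
      "?W X Y * of_bool (F Y \<le> t) \<le> ?W X Y * of_bool (F X \<le> t + \<eta>) + ?W X Y * (F X - F Y)\<^sup>2 / \<eta>\<^sup>2" for X Y
  proof -
    have "of_bool (F X \<le> t - \<eta>) \<le> of_bool (F Y \<le> t) + (F X - F Y)\<^sup>2 / \<eta>\<^sup>2"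
      using one[of X Y] by (cases "F X \<le> t - \<eta>"; cases "F Y \<le> t") auto
    from mult_left_mono[OF this coupling_nonneg[of N m X Y]]
    show "?W X Y * of_bool (F X \<le> t - \<eta>) \<le> ?W X Y * of_bool (F Y \<le> t) + ?W X Y * (F X - F Y)\<^sup>2 / \<eta>\<^sup>2"
      by (simp add: distrib_left)
    have "of_bool (F Y \<le> t) \<le> of_bool (F X \<le> t + \<eta>) + (F X - F Y)\<^sup>2 / \<eta>\<^sup>2"
      using one[of X Y] by (cases "F X \<le> t + \<eta>"; cases "F Y \<le> t") auto
    from mult_left_mono[OF this coupling_nonneg[of N m X Y]]
    show "?W X Y * of_bool (F Y \<le> t) \<le> ?W X Y * of_bool (F X \<le> t + \<eta>) + ?W X Y * (F X - F Y)\<^sup>2 / \<eta>\<^sup>2"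
      by (simp add: distrib_left)
  qed
  have "cube_avg N (\<lambda>X. of_bool (F X \<le> t - \<eta>))
      \<le> (\<Sum>X\<in>Pow N. \<Sum>Y\<in>Pow N. ?W X Y * of_bool (F Y \<le> t) + ?W X Y * (F X - F Y)\<^sup>2 / \<eta>\<^sup>2)"
    unfolding coupling_sum_cube[OF N, symmetric] by (intro sum_mono pt)
  then show "cube_avg N (\<lambda>X. of_bool (F X \<le> t - \<eta>)) - \<eta> \<le> slice_avg N m (\<lambda>X. of_bool (F X \<le> t))"
    using M coupling_sum_slice[OF N, of "\<lambda>X. of_bool (F X \<le> t)"] by (simp add: sum.distrib)
  have "slice_avg N m (\<lambda>X. of_bool (F X \<le> t))
      \<le> (\<Sum>X\<in>Pow N. \<Sum>Y\<in>Pow N. ?W X Y * of_bool (F X \<le> t + \<eta>) + ?W X Y * (F X - F Y)\<^sup>2 / \<eta>\<^sup>2)"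
    unfolding coupling_sum_slice[OF N, symmetric] by (intro sum_mono pt)
  then show "slice_avg N m (\<lambda>X. of_bool (F X \<le> t)) \<le> cube_avg N (\<lambda>X. of_bool (F X \<le> t + \<eta>)) + \<eta>"
    using M coupling_sum_cube[OF N, of "\<lambda>X. of_bool (F X \<le> t + \<eta>)"] by (simp add: sum.distrib)
qed

section \<open>Polynomials and measures in terms of sets\<close>

definition set_coeff :: "mpolynomial \<Rightarrow> nat set \<Rightarrow> real" where
  "set_coeff p A = (\<Sum>m | m \<in> Poly_Mapping.keys p \<and> Poly_Mapping.keys m = A. Poly_Mapping.lookup p m)"

definition cube_point :: "nat set \<Rightarrow> nat set \<Rightarrow> nat \<Rightarrow> real" where
  "cube_point N X = (\<lambda>i\<in>N. of_bool (i \<in> X))"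

lemma multilinear_lookup:
  assumes "multilinear p" "m \<in> Poly_Mapping.keys p"
  shows "Poly_Mapping.lookup m i = of_bool (i \<in> Poly_Mapping.keys m)"
proof -
  have "Poly_Mapping.lookup m i \<le> 1" using assms by (simp add: multilinear_def)
  then show ?thesis by (auto simp: in_keys_iff)
qed

lemma sum_by_keys:
  assumes "finite N" "mpoly_vars p \<subseteq> N"
  shows "(\<Sum>A\<in>Pow N. \<Sum>m | m \<in> Poly_Mapping.keys p \<and> Poly_Mapping.keys m = A. g m) = (\<Sum>m\<in>Poly_Mapping.keys p. g m)"
  by (rule sum.group) (use assms in \<open>auto simp: mpoly_vars_def\<close>)

text \<open>
  A multilinear monomial is determined by its set of variables.
\<close>

lemma mpoly_eval_cube_point:
  assumes N: "finite N" "mpoly_vars p \<subseteq> N" and ml: "multilinear p"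
  shows "mpoly_eval p (cube_point N X) = mlin N (set_coeff p) X"
proof -
  have "mpoly_eval p (cube_point N X) = (\<Sum>m\<in>Poly_Mapping.keys p. Poly_Mapping.lookup p m * of_bool (Poly_Mapping.keys m \<subseteq> X))"
    unfolding mpoly_eval_def
  proof (rule sum.cong[OF refl])
    fix m assume m: "m \<in> Poly_Mapping.keys p"
    have "(\<Prod>i\<in>Poly_Mapping.keys m. cube_point N X i ^ Poly_Mapping.lookup m i) = (\<Prod>i\<in>Poly_Mapping.keys m. of_bool (i \<in> X))"
    proof (rule prod.cong[OF refl])
      fix i assume i: "i \<in> Poly_Mapping.keys m"
      then have "i \<in> N" using m N(2) by (auto simp: mpoly_vars_def)
      then show "cube_point N X i ^ Poly_Mapping.lookup m i = of_bool (i \<in> X)"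
        using i by (simp add: multilinear_lookup[OF ml m] cube_point_def)
    qed
    then show "Poly_Mapping.lookup p m * (\<Prod>i\<in>Poly_Mapping.keys m. cube_point N X i ^ Poly_Mapping.lookup m i) = Poly_Mapping.lookup p m * of_bool (Poly_Mapping.keys m \<subseteq> X)"
      by (simp add: prod_of_bool subset_eq)
  qed
  also have "\<dots> = mlin N (set_coeff p) X"
    unfolding mlin_def set_coeff_def sum_by_keys[OF N, symmetric] sum_distrib_right
    by (intro sum.cong refl) auto
  finally show ?thesis .
qed

lemma card_le_mpoly_degree:
  assumes "set_coeff p A \<noteq> 0"
  shows "card A \<le> mpoly_degree p"
proof -
  have "\<exists>m. m \<in> Poly_Mapping.keys p \<and> Poly_Mapping.keys m = A"
  proof (rule ccontr)
    assume "\<not> ?thesis"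
    then have "{m. m \<in> Poly_Mapping.keys p \<and> Poly_Mapping.keys m = A} = {}" by blast
    then show False using assms by (simp only: set_coeff_def sum.empty)
  qed
  then obtain m where m: "m \<in> Poly_Mapping.keys p" "Poly_Mapping.keys m = A" by blast
  have "card A = (\<Sum>i\<in>Poly_Mapping.keys m. 1)" using m(2) by simp
  also have "\<dots> \<le> monomial_degree m"
    unfolding monomial_degree_def by (intro sum_mono) (simp add: in_keys_iff)
  also have "\<dots> \<le> mpoly_degree p"
    unfolding mpoly_degree_def using m(1) by (intro Max_ge) auto
  finally show ?thesis .
qed

text \<open>
  Compare the coefficients of the squarefree monomial with variable set \<open>B\<close> in the sum of the partial
  derivatives.
\<close>

lemma coeff_harmonic_set_coeff:
  assumes har: "harmonic n p" and ml: "multilinear p"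
  shows "coeff_harmonic {1..n} (set_coeff p)"
  unfolding coeff_harmonic_def
proof (intro allI impI)
  fix B assume B: "B \<subseteq> {1..n}"
  then have fB: "finite B" by (rule finite_subset) simp
  define mB :: monomial where "mB = (\<Sum>i\<in>B. Poly_Mapping.single i 1)"
  have mB: "Poly_Mapping.lookup mB j = of_bool (j \<in> B)" for j
  proof -
    have "Poly_Mapping.lookup mB j = (\<Sum>i\<in>B. if i = j then 1 else 0)"
      unfolding mB_def lookup_sum by (intro sum.cong) (auto simp: lookup_single when_def)
    then show ?thesis using fB by simp
  qed
  have coeff: "Poly_Mapping.lookup (Poly_Mapping.single (m - Poly_Mapping.single i 1) (real (Poly_Mapping.lookup m i) * Poly_Mapping.lookup p m)) mB
      = (if i \<notin> B \<and> Poly_Mapping.keys m = insert i B then Poly_Mapping.lookup p m else 0)"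
    if m: "m \<in> Poly_Mapping.keys p" for m i
  proof (cases "i \<in> Poly_Mapping.keys m")
    case False
    then show ?thesis by (auto simp: multilinear_lookup[OF ml m])
  next
    case True
    have "m - Poly_Mapping.single i 1 = mB \<longleftrightarrow> i \<notin> B \<and> Poly_Mapping.keys m = insert i B"
    proof -
      have "m - Poly_Mapping.single i 1 = mB \<longleftrightarrow> (\<forall>j. Poly_Mapping.lookup m j - (if i = j then 1 else 0) = of_bool (j \<in> B))"
        by (auto simp: poly_mapping_eq_iff fun_eq_iff lookup_minus lookup_single when_def mB)
      also have "\<dots> \<longleftrightarrow> i \<notin> B \<and> Poly_Mapping.keys m = insert i B"
        unfolding multilinear_lookup[OF ml m] using True by (auto split: if_splits simp: of_bool_def)
      finally show ?thesis .
    qed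
    then show ?thesis using True by (auto simp: multilinear_lookup[OF ml m] lookup_single when_def)
  qed
  have "0 = Poly_Mapping.lookup (\<Sum>i=1..n. mpoly_deriv i p) mB"
    using har by (simp add: harmonic_def)
  also have "\<dots> = (\<Sum>i=1..n. \<Sum>m\<in>Poly_Mapping.keys p. if i \<notin> B \<and> Poly_Mapping.keys m = insert i B then Poly_Mapping.lookup p m else 0)"
    unfolding mpoly_deriv_def lookup_sum by (intro sum.cong refl coeff)
  also have "\<dots> = (\<Sum>i=1..n. if i \<notin> B then set_coeff p (insert i B) else 0)"
    by (intro sum.cong refl) (auto simp: set_coeff_def sum.If_cases Int_def)
  also have "\<dots> = (\<Sum>i\<in>{1..n} - B. set_coeff p (insert i B))"
    by (rule sum.mono_neutral_cong_right) auto
  finally show "(\<Sum>i\<in>{1..n} - B. set_coeff p (insert i B)) = 0" by simp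
qed

lemma bij_betw_cube_point: "bij_betw (cube_point {1..n}) (Pow {1..n}) (cube n)"
proof (rule bij_betwI[where g = "\<lambda>x. {i \<in> {1..n}. x i = 1}"])
  show "cube_point {1..n} \<in> Pow {1..n} \<rightarrow> cube n"
    by (auto simp: cube_point_def cube_def)
  show "(\<lambda>x. {i \<in> {1..n}. x i = 1}) \<in> cube n \<rightarrow> Pow {1..n}" by auto
  show "{i \<in> {1..n}. cube_point {1..n} X i = 1} = X" if "X \<in> Pow {1..n}" for X
    using that by (auto simp: cube_point_def)
  show "cube_point {1..n} {i \<in> {1..n}. x i = 1} = x" if "x \<in> cube n" for x
  proof
    fix i
    show "cube_point {1..n} {i \<in> {1..n}. x i = 1} i = x i"
    proof (cases "i \<in> {1..n}")
      case True
      then have "x i \<in> {0, 1}" using that unfolding cube_def by (rule PiE_mem[rotated])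
      then show ?thesis using True by (auto simp: cube_point_def)
    next
      case False
      then have "x i = undefined"
        using that unfolding cube_def by (intro PiE_arb)
      then show ?thesis using False unfolding cube_point_def by (simp only: restrict_apply if_False)
    qed
  qed
qed

lemma sum_cube_point:
  assumes "X \<subseteq> {1..n}"
  shows "(\<Sum>i=1..n. cube_point {1..n} X i) = real (card X)"
proof -
  have "(\<Sum>i=1..n. cube_point {1..n} X i) = (\<Sum>i\<in>{1..n}. if i \<in> X then 1 else 0)"
    by (intro sum.cong) (auto simp: cube_point_def)
  also have "\<dots> = real (card ({1..n} \<inter> X))" by (simp add: sum.If_cases)
  finally show ?thesis using assms by (simp add: Int_absorb1)
qed

lemma bij_betw_cube_point_slice:
  assumes "n = 2 * m"
  shows "bij_betw (cube_point {1..n}) {X. X \<subseteq> {1..n} \<and> card X = m} (middle_slice n)"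
  unfolding bij_betw_def
proof
  have b: "inj_on (cube_point {1..n}) (Pow {1..n})" "cube_point {1..n} ` Pow {1..n} = cube n"
    using bij_betw_cube_point[of n] by (auto simp: bij_betw_def)
  show "inj_on (cube_point {1..n}) {X. X \<subseteq> {1..n} \<and> card X = m}"
    by (rule inj_on_subset[OF b(1)]) auto
  have iff: "cube_point {1..n} X \<in> middle_slice n \<longleftrightarrow> card X = m" if "X \<subseteq> {1..n}" for X
  proof -
    have "cube_point {1..n} X \<in> cube n" using that b(2) by blast
    then show ?thesis
      unfolding middle_slice_def mem_Collect_eq sum_cube_point[OF that] using assms by auto
  qed
  show "cube_point {1..n} ` {X. X \<subseteq> {1..n} \<and> card X = m} = middle_slice n"
  proof (intro equalityI subsetI)
    fix x assume "x \<in> cube_point {1..n} ` {X. X \<subseteq> {1..n} \<and> card X = m}"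
    then show "x \<in> middle_slice n" using iff by blast
  next
    fix x assume x: "x \<in> middle_slice n"
    then have "x \<in> cube_point {1..n} ` Pow {1..n}" unfolding b(2) by (simp add: middle_slice_def)
    then show "x \<in> cube_point {1..n} ` {X. X \<subseteq> {1..n} \<and> card X = m}" using x iff by blast
  qed
qed

lemma cube_finite_nonempty: "finite (cube n)" "cube n \<noteq> {}"
  by (simp_all add: cube_def finite_PiE PiE_eq_empty_iff)

lemma expectation_cube_pmf:
  "measure_pmf.expectation (cube_pmf n) g = cube_avg {1..n} (\<lambda>X. g (cube_point {1..n} X))"
proof -
  have "sum g (cube n) = (\<Sum>X\<in>Pow {1..n}. g (cube_point {1..n} X))"
    by (rule sum.reindex_bij_betw[OF bij_betw_cube_point, symmetric])
  moreover have "card (cube n) = 2 ^ n"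
    using bij_betw_same_card[OF bij_betw_cube_point[of n]] by (simp add: card_Pow)
  ultimately show ?thesis
    using cube_finite_nonempty[of n] by (simp add: cube_pmf_def integral_pmf_of_set cube_avg_def)
qed

lemma middle_slice_finite_nonempty:
  assumes "n = 2 * m"
  shows "finite (middle_slice n)" "middle_slice n \<noteq> {}"
proof -
  show "finite (middle_slice n)"
    by (rule finite_subset[OF _ cube_finite_nonempty(1)[of n]]) (auto simp: middle_slice_def)
  have "card (middle_slice n) = n choose m"
    using bij_betw_same_card[OF bij_betw_cube_point_slice[OF assms]] by (simp add: n_subsets)
  moreover have "n choose m > 0" using assms by simp
  ultimately show "middle_slice n \<noteq> {}" by (metis card.empty less_irrefl)
qed

lemma expectation_slice_pmf:
  assumes "n = 2 * m"
  shows "measure_pmf.expectation (slice_pmf n) g = slice_avg {1..n} m (\<lambda>X. g (cube_point {1..n} X))"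
proof -
  have "sum g (middle_slice n) = (\<Sum>X | X \<subseteq> {1..n} \<and> card X = m. g (cube_point {1..n} X))"
    by (rule sum.reindex_bij_betw[OF bij_betw_cube_point_slice[OF assms], symmetric])
  moreover have "card (middle_slice n) = n choose m"
    using bij_betw_same_card[OF bij_betw_cube_point_slice[OF assms]] by (simp add: n_subsets)
  ultimately show ?thesis
    using middle_slice_finite_nonempty[OF assms] by (simp add: slice_pmf_def integral_pmf_of_set slice_avg_def)
qed

lemma cdf_map_pmf:
  "cdf (measure_pmf (map_pmf g P)) t = measure_pmf.expectation P (\<lambda>x. of_bool (g x \<le> t))"
proof -
  have "cdf (measure_pmf (map_pmf g P)) t = measure (measure_pmf P) {x. g x \<le> t}"
    by (simp add: cdf_def vimage_def)
  also have "\<dots> = measure_pmf.expectation P (indicator {x. g x \<le> t})"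
    by simp
  also have "\<dots> = measure_pmf.expectation P (\<lambda>x. of_bool (g x \<le> t))"
    by (rule Bochner_Integration.integral_cong) (auto simp: indicator_def)
  finally show ?thesis .
qed

text \<open>
  A negative number cannot be admissible, by monotonicity of the distribution function; so the
  infimum is over a set of nonnegative numbers that contains \<open>\<eta>\<close>.
\<close>

lemma abs_levy_distance_le:
  assumes \<eta>: "\<And>t. cdf (measure_pmf P) (t - \<eta>) - \<eta> \<le> cdf (measure_pmf Q) t"
      "\<And>t. cdf (measure_pmf Q) t \<le> cdf (measure_pmf P) (t + \<eta>) + \<eta>"
  shows "\<bar>levy_distance (measure_pmf P) (measure_pmf Q)\<bar> \<le> \<eta>"
proof -
  let ?A = "{\<epsilon>. \<forall>t. cdf (measure_pmf P) (t - \<epsilon>) - \<epsilon> \<le> cdf (measure_pmf Q) t \<and> cdf (measure_pmf Q) t \<le> cdf (measure_pmf P) (t + \<epsilon>) + \<epsilon>}"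
  have nonneg: "\<epsilon> \<ge> 0" if "\<epsilon> \<in> ?A" for \<epsilon>
  proof (rule ccontr)
    assume neg: "\<not> 0 \<le> \<epsilon>"
    have "cdf (measure_pmf P) (0 - \<epsilon>) - \<epsilon> \<le> cdf (measure_pmf P) (0 + \<epsilon>) + \<epsilon>"
    proof -
      have "cdf (measure_pmf P) (0 - \<epsilon>) - \<epsilon> \<le> cdf (measure_pmf Q) 0 \<and> cdf (measure_pmf Q) 0 \<le> cdf (measure_pmf P) (0 + \<epsilon>) + \<epsilon>"
        using that by blast
      then show ?thesis by linarith
    qed
    moreover have "cdf (measure_pmf P) (0 + \<epsilon>) \<le> cdf (measure_pmf P) (0 - \<epsilon>)"
      unfolding cdf_def using neg by (intro measure_pmf.finite_measure_mono) auto
    ultimately show False using neg by linarith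
  qed
  have mem: "\<eta> \<in> ?A" using \<eta> by simp
  have "Inf ?A \<le> \<eta>" using nonneg by (intro cInf_lower mem bdd_belowI[of _ 0])
  moreover have "0 \<le> Inf ?A" using mem nonneg by (intro cInf_greatest) auto
  ultimately show ?thesis unfolding levy_distance_def by simp
qed

section \<open>Invariance for harmonic polynomials of degree \<open>o(sqrt n)\<close>\<close>

text \<open>
  The denominator \<open>sqrt n\<close> comes from the mean gap, at most \<open>sqrt n / 2\<close>, relative to \<open>m = n / 2\<close>.
\<close>

lemma harmonic_polynomial_mean_square:
  assumes n: "n = 2 * m" "m > 0" and vars: "mpoly_vars p \<subseteq> {1..n}" and ml: "multilinear p" and har: "harmonic n p"
    and deg: "2 * mpoly_degree p \<le> n" and var: "measure_pmf.variance (slice_pmf n) (mpoly_eval p) = 1"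
  defines "F \<equiv> mlin {1..n} (set_coeff p)"
  shows "(\<Sum>X\<in>Pow {1..n}. \<Sum>Y\<in>Pow {1..n}. coupling {1..n} m X Y * (F X - F Y)\<^sup>2) \<le> 2 * real (mpoly_degree p) / sqrt (real n)"
proof -
  let ?N = "{1..n}" and ?K = "mpoly_degree p"
  have pairs: "disjoint_pairs ?N ?K Suc (\<lambda>i. Suc (i + ?K))"
    using deg by (auto simp: disjoint_pairs_def inj_on_def)
  have eval: "mpoly_eval p (cube_point ?N X) = F X" for X
    unfolding F_def by (rule mpoly_eval_cube_point[OF _ vars ml]) simp
  have int: "integrable (measure_pmf (slice_pmf n)) h" for h :: "(nat \<Rightarrow> real) \<Rightarrow> real"
    using middle_slice_finite_nonempty[OF n(1)] by (intro integrable_measure_pmf_finite) (simp add: slice_pmf_def)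
  have "slice_avg ?N m (\<lambda>X. (F X)\<^sup>2) - (slice_avg ?N m F)\<^sup>2 = 1"
    using var unfolding measure_pmf.variance_eq[OF int int] by (simp only: expectation_slice_pmf[OF n(1)] eval)
  then have "(\<Sum>X\<in>Pow ?N. \<Sum>Y\<in>Pow ?N. coupling ?N m X Y * (F X - F Y)\<^sup>2) \<le> 2 * real ?K * mean_gap ?N m / real m"
    using coupling_mean_square_le[OF _ _ n(2) coeff_harmonic_set_coeff[OF har ml] pairs card_le_mpoly_degree] n(1)
    unfolding F_def by simp
  also have "\<dots> \<le> 2 * real ?K * (sqrt (real n) / 2) / real m"
    using mean_gap_le[of ?N m] n(1) by (intro divide_right_mono mult_left_mono) auto
  also have "\<dots> = 2 * real ?K / sqrt (real n)"
  proof -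
    have "real m = sqrt (real n) * sqrt (real n) / 2" using n(1) by simp
    moreover have "sqrt (real n) > 0" using n by simp
    ultimately show ?thesis by (simp add: field_simps)
  qed
  finally show ?thesis .
qed

lemma eventually_even_at_top: "eventually P even_at_top \<longleftrightarrow> eventually (\<lambda>n. even n \<longrightarrow> P n) at_top"
  by (simp add: even_at_top_def eventually_inf_principal)

theorem theorem1p2:
  fixes d :: "nat \<Rightarrow> real" and f :: "nat \<Rightarrow> mpolynomial"
  assumes "d \<in> o(\<lambda>n. sqrt (real n))"
    and "\<And>n. even n \<Longrightarrow> n > 0 \<Longrightarrow> mpoly_vars (f n) \<subseteq> {1..n}"
    and "\<And>n. even n \<Longrightarrow> n > 0 \<Longrightarrow> multilinear (f n)"
    and "\<And>n. even n \<Longrightarrow> n > 0 \<Longrightarrow> harmonic n (f n)"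
    and "\<And>n. even n \<Longrightarrow> n > 0 \<Longrightarrow> real (mpoly_degree (f n)) \<le> d n"
    and "\<And>n. even n \<Longrightarrow> n > 0 \<Longrightarrow> measure_pmf.variance (slice_pmf n) (mpoly_eval (f n)) = 1"
  shows "(\<forall>\<phi> :: nat \<Rightarrow> real \<Rightarrow> real.
            (\<forall>n. even n \<longrightarrow> n > 0 \<longrightarrow> 1-lipschitz_on UNIV (\<phi> n)) \<longrightarrow>
            (\<lambda>n. \<bar>measure_pmf.expectation (slice_pmf n) (\<lambda>x. \<phi> n (mpoly_eval (f n) x)) -
                  measure_pmf.expectation (cube_pmf n) (\<lambda>x. \<phi> n (mpoly_eval (f n) x))\<bar>)
              \<in> o[even_at_top](\<lambda>_. 1)) \<and>
         (\<lambda>n. levy_distance (measure_pmf (map_pmf (mpoly_eval (f n)) (cube_pmf n)))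
                             (measure_pmf (map_pmf (mpoly_eval (f n)) (slice_pmf n))))
           \<in> o[even_at_top](\<lambda>_. 1)"
proof -
  define F where "F n = mlin {1..n} (set_coeff (f n))" for n
  have eval: "mpoly_eval (f n) (cube_point {1..n} X) = F n X" if "even n" "n > 0" for n X
    unfolding F_def using assms(2,3)[OF that] by (intro mpoly_eval_cube_point) auto
  have small: "eventually (\<lambda>n. even n \<longrightarrow> n > 0 \<and>
      (\<Sum>X\<in>Pow {1..n}. \<Sum>Y\<in>Pow {1..n}. coupling {1..n} (n div 2) X Y * (F n X - F n Y)\<^sup>2) \<le> \<tau>) at_top"
    if \<tau>: "\<tau> > 0" for \<tau> :: real
  proof -
    \<comment> \<open>The first bound makes \<open>2 * d n / sqrt n\<close> at most \<open>\<tau>\<close>, the second makes twice the degree at most \<open>n\<close>.\<close>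
    define \<kappa> where "\<kappa> = min (\<tau> / 2) (1 / 2)"
    have \<kappa>: "\<kappa> > 0" "\<kappa> \<le> \<tau> / 2" "\<kappa> \<le> 1 / 2" using \<tau> by (auto simp: \<kappa>_def)
    have "eventually (\<lambda>n. norm (d n) \<le> \<kappa> * norm (sqrt (real n))) at_top"
      by (rule landau_o.smallD[OF assms(1) \<kappa>(1)])
    moreover have "eventually (\<lambda>n::nat. n > 0) at_top" by (rule eventually_gt_at_top)
    ultimately show ?thesis
    proof eventually_elim
      case (elim n)
      show ?case
      proof
        assume even: "even n"
        define K where "K = mpoly_degree (f n)"
        have nm: "n = 2 * (n div 2)" "n div 2 > 0" using even elim(2) by auto
        have s: "sqrt (real n) > 0" "sqrt (real n) \<le> real n"
          using elim(2) by (auto intro!: real_le_lsqrt simp: power2_eq_square)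
        have "real K \<le> \<kappa> * sqrt (real n)"
          using assms(5)[OF even elim(2)] elim(1) by (auto simp: K_def)
        moreover have "\<kappa> * sqrt (real n) \<le> 1 / 2 * real n"
          using \<kappa> s by (intro mult_mono) auto
        ultimately have K: "2 * real K / sqrt (real n) \<le> 2 * \<kappa>" "2 * K \<le> n"
          using s(1) by (auto simp: field_simps)
        have "(\<Sum>X\<in>Pow {1..n}. \<Sum>Y\<in>Pow {1..n}. coupling {1..n} (n div 2) X Y * (F n X - F n Y)\<^sup>2) \<le> 2 * real K / sqrt (real n)"
          unfolding F_def K_def using K(2) assms(2,3,4,6)[OF even elim(2)]
          by (intro harmonic_polynomial_mean_square nm) (auto simp: K_def)
        then show "n > 0 \<and> (\<Sum>X\<in>Pow {1..n}. \<Sum>Y\<in>Pow {1..n}. coupling {1..n} (n div 2) X Y * (F n X - F n Y)\<^sup>2) \<le> \<tau>"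
          using K(1) \<kappa>(2) elim(2) by auto
      qed
    qed
  qed
  have size: "finite {1..n}" "n div 2 \<le> card {1..n}" "n = 2 * (n div 2)" if "even n" for n :: nat
    using that by auto
  show ?thesis
  proof (intro conjI allI impI)
    fix \<phi> :: "nat \<Rightarrow> real \<Rightarrow> real"
    assume lip: "\<forall>n. even n \<longrightarrow> n > 0 \<longrightarrow> 1-lipschitz_on UNIV (\<phi> n)"
    show "(\<lambda>n. \<bar>measure_pmf.expectation (slice_pmf n) (\<lambda>x. \<phi> n (mpoly_eval (f n) x)) -
                  measure_pmf.expectation (cube_pmf n) (\<lambda>x. \<phi> n (mpoly_eval (f n) x))\<bar>)
              \<in> o[even_at_top](\<lambda>_. 1)"
    proof (rule landau_o.smallI)
      fix c :: real assume c: "c > 0"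
      \<comment> \<open>\<open>lipschitz_averages_close\<close> turns a mean square of \<open>(c / 2)\<^sup>2\<close> into a distance of \<open>c\<close>.\<close>
      then have "(c / 2)\<^sup>2 > 0" by simp
      from small[OF this]
      show "\<forall>\<^sub>F n in even_at_top. norm \<bar>measure_pmf.expectation (slice_pmf n) (\<lambda>x. \<phi> n (mpoly_eval (f n) x)) -
                  measure_pmf.expectation (cube_pmf n) (\<lambda>x. \<phi> n (mpoly_eval (f n) x))\<bar> \<le> c * norm (1::real)"
        unfolding eventually_even_at_top
      proof eventually_elim
        case (elim n)
        show ?case
        proof
          assume even: "even n"
          then have n: "n > 0" using elim by simp
          have "\<bar>slice_avg {1..n} (n div 2) (\<lambda>X. \<phi> n (F n X)) - cube_avg {1..n} (\<lambda>X. \<phi> n (F n X))\<bar> \<le> 2 * (c / 2)"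
            by (rule lipschitz_averages_close) (use size[OF even] lip n even c elim in auto)
          then show "norm \<bar>measure_pmf.expectation (slice_pmf n) (\<lambda>x. \<phi> n (mpoly_eval (f n) x)) -
                  measure_pmf.expectation (cube_pmf n) (\<lambda>x. \<phi> n (mpoly_eval (f n) x))\<bar> \<le> c * norm (1::real)"
            by (simp add: expectation_slice_pmf[OF size(3)[OF even]] expectation_cube_pmf eval[OF even n] del: One_nat_def)
        qed
      qed
    qed
  next
    show "(\<lambda>n. levy_distance (measure_pmf (map_pmf (mpoly_eval (f n)) (cube_pmf n)))
                             (measure_pmf (map_pmf (mpoly_eval (f n)) (slice_pmf n))))
           \<in> o[even_at_top](\<lambda>_. 1)"
    proof (rule landau_o.smallI)
      fix c :: real assume c: "c > 0"
      \<comment> \<open>The exponent 3 accounts for the loss in Markov's inequality, see \<open>coupled_distribution_functions\<close>.\<close>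
      then have "c ^ 3 > 0" by simp
      from small[OF this]
      show "\<forall>\<^sub>F n in even_at_top. norm (levy_distance (measure_pmf (map_pmf (mpoly_eval (f n)) (cube_pmf n)))
                             (measure_pmf (map_pmf (mpoly_eval (f n)) (slice_pmf n)))) \<le> c * norm (1::real)"
        unfolding eventually_even_at_top
      proof eventually_elim
        case (elim n)
        show ?case
        proof
          assume even: "even n"
          then have n: "n > 0" using elim by simp
          have ms: "(\<Sum>X\<in>Pow {1..n}. \<Sum>Y\<in>Pow {1..n}. coupling {1..n} (n div 2) X Y * (F n X - F n Y)\<^sup>2) \<le> c ^ 3"
            using elim even by simp
          have "\<bar>levy_distance (measure_pmf (map_pmf (mpoly_eval (f n)) (cube_pmf n)))
                             (measure_pmf (map_pmf (mpoly_eval (f n)) (slice_pmf n)))\<bar> \<le> c"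
            by (rule abs_levy_distance_le;
                unfold cdf_map_pmf expectation_slice_pmf[OF size(3)[OF even]] expectation_cube_pmf eval[OF even n];
                rule coupled_distribution_functions[OF size(1,2)[OF even] c ms])
          then show "norm (levy_distance (measure_pmf (map_pmf (mpoly_eval (f n)) (cube_pmf n)))
                             (measure_pmf (map_pmf (mpoly_eval (f n)) (slice_pmf n)))) \<le> c * norm (1::real)"
            by simp
        qed
      qed
    qed
  qed
qed

end
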